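(* For every $n\geq 1$, the map $(T,e)\mapsto \mathrm{Insertpoint}(T,e)$ is a bijection between the set of pairs $(T,e)$, where $T\in\mathcal{T}_n$ and $e$ is one of the $n+1$ boundary edges of $T$, and the set $\mathcal{T}_{n+1}$.
   Context: A Ferrers diagram is a finite set of unit cells of $\mathbb{Z}^2$ forming left-justified rows whose lengths weakly decrease from top to bottom, considered up to translation. Its boundary edges are the unit edges on its Southeast border path (from its bottom-left corner to its top-right corner); their number equals the half-perimeter (number of rows plus number of columns). A boundary cell is a cell with no other cell of the diagram to its Southeast. Boundary edges and boundary cells are ordered from Southwest to Northeast along the border path; the Southeast corners of boundary cells interleave with boundary edges. A tree-like tableau is a Ferrers diagram in which each cell is either empty or pointed, such that: (1) the top-left cell is pointed (the root point); (2) every non-root pointed cell has either a pointed cell above it in its column or a pointed cell to its left in its row, but not both; (3) every row and every column contains a pointed cell. A tree-like tableau of half-perimeter $n+1$ has exactly $n$ points; $n$ is its size, and $\mathcal{T}_n$ denotes the set of tree-like tableaux of size $n$. Inserting a column at a boundary edge $e$ which is the right end of a row $r$ means adding one cell at the right end of $r$ and of every row above $r$; inserting a row at a boundary edge $e$ which is the bottom end of a column $c$ means adding one cell at the bottom of $c$ and of every column to the left of $c$. The special point of $T$ is the Northeast-most (i.e. rightmost) among the pointed cells which are the lowest cell of their column (its cell is a boundary cell). $\mathrm{Insertpoint}(T,e)$ is defined as follows: let $T'$ be obtained by inserting a column (if $e$ is vertical) or a row (if $e$ is horizontal) at $e$, with all new cells empty except the lowest cell of the new column (resp. the rightmost cell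 of the new row), which is pointed. (1) If $e$ lies Northeast of the special point of $T$ along the border path (i.e. after the bottom edge of the special cell in the Southwest-to-Northeast order), then $\mathrm{Insertpoint}(T,e)=T'$. (2) Otherwise, add to $T'$ the ribbon of empty cells (a connected set of cells containing no $2\times 2$ square, whose union with $T'$ is a Ferrers diagram) starting at the cell immediately to the right of the new point and ending at the cell immediately below the special point of $T$; if $e$ is the bottom edge of the special cell, nothing is added. The result is $\mathrm{Insertpoint}(T,e)$, a tree-like tableau of size $n+1$. *)

theory Defs
  imports Main
begin

text \<open>
  The cell in row \<open>i\<close> (counted from the top) and column \<open>j\<close> (counted from the left) is the pair
  \<open>(i, j)\<close>, both indices starting at 0.  Diagrams up to translation are represented by placing
  the top-left cell at \<open>(0, 0)\<close>.
\<close>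

type_synonym cell = "nat \<times> nat"

definition ferrers :: "cell set \<Rightarrow> bool" where
  "ferrers D \<longleftrightarrow> finite D \<and> (\<forall>(i, j)\<in>D. \<forall>i'\<le>i. \<forall>j'\<le>j. (i', j') \<in> D)"

datatype tableau = Tableau (cells: "cell set") (points: "cell set")

definition tree_like :: "tableau \<Rightarrow> bool" where
  "tree_like T \<longleftrightarrow> ferrers (cells T) \<and> points T \<subseteq> cells T \<and>
     (0, 0) \<in> points T \<and>
     (\<forall>(i, j)\<in>points T. (i, j) \<noteq> (0, 0) \<longrightarrow>
        (\<exists>i'<i. (i', j) \<in> points T) \<noteq> (\<exists>j'<j. (i, j') \<in> points T)) \<and>
     (\<forall>(i, j)\<in>cells T. (\<exists>j'. (i, j') \<in> points T) \<and> (\<exists>i'. (i', j) \<in> points T))"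

definition TLT :: "nat \<Rightarrow> tableau set" where
  "TLT n = {T. tree_like T \<and> card (points T) = n}"

text \<open>
  \<open>RightEdge p\<close> and \<open>BottomEdge p\<close> are the right (vertical) and bottom (horizontal) sides of the
  cell \<open>p\<close>.  In a Ferrers diagram such a side lies on the Southeast border path exactly when
  the cell on its other side is not in the diagram.
\<close>

datatype edge = RightEdge cell | BottomEdge cell

definition boundary_edges :: "tableau \<Rightarrow> edge set" where
  "boundary_edges T =
     {RightEdge (i, j) |i j. (i, j) \<in> cells T \<and> (i, Suc j) \<notin> cells T} \<union>
     {BottomEdge (i, j) |i j. (i, j) \<in> cells T \<and> (Suc i, j) \<notin> cells T}"

text \<open>
  With \<open>(i, j)\<close> also naming the top-left corner of the cell \<open>(i, j)\<close>, each step of the border path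
  (East or North) increases ``column minus row'' by one.  The value at the Southwest endpoint
  of an edge therefore orders the boundary edges from Southwest to Northeast.
\<close>

fun edge_pos :: "edge \<Rightarrow> int" where
  "edge_pos (RightEdge (i, j)) = int (j + 1) - int (i + 1)"
| "edge_pos (BottomEdge (i, j)) = int j - int (i + 1)"

definition column_bottom_points :: "tableau \<Rightarrow> cell set" where
  "column_bottom_points T = {(i, j) \<in> points T. (Suc i, j) \<notin> cells T}"

definition special_point :: "tableau \<Rightarrow> cell" where
  "special_point T = (THE p. p \<in> column_bottom_points T \<and>
     (\<forall>q\<in>column_bottom_points T. snd q \<le> snd p))"

text \<open>
  Inserting a column (row) at an edge moves the existing columns (rows) beyond that edge by one
  step, together with their points; on shapes this adds one cell to the row (column) of the edge
  and to every row above it (every column to its left).  \<open>shift_cell e\<close> maps the cells of the old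
  tableau to their positions in the new one.
\<close>

fun shift_cell :: "edge \<Rightarrow> cell \<Rightarrow> cell" where
  "shift_cell (RightEdge (r, c)) (i, j) = (i, if c < j then Suc j else j)"
| "shift_cell (BottomEdge (r, c)) (i, j) = (if r < i then Suc i else i, j)"

fun new_cells :: "edge \<Rightarrow> cell set" where
  "new_cells (RightEdge (r, c)) = {(i, Suc c) |i. i \<le> r}"
| "new_cells (BottomEdge (r, c)) = {(Suc r, j) |j. j \<le> c}"

fun new_point :: "edge \<Rightarrow> cell" where
  "new_point (RightEdge (r, c)) = (r, Suc c)"
| "new_point (BottomEdge (r, c)) = (Suc r, c)"

definition insert_line :: "tableau \<Rightarrow> edge \<Rightarrow> tableau" where
  "insert_line T e = Tableau (shift_cell e ` cells T \<union> new_cells e)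
     (insert (new_point e) (shift_cell e ` points T))"

definition adjacent :: "cell \<Rightarrow> cell \<Rightarrow> bool" where
  "adjacent p q \<longleftrightarrow>
     (fst p = fst q \<and> (snd q = Suc (snd p) \<or> snd p = Suc (snd q))) \<or>
     (snd p = snd q \<and> (fst q = Suc (fst p) \<or> fst p = Suc (fst q)))"

definition connected_cells :: "cell set \<Rightarrow> bool" where
  "connected_cells R \<longleftrightarrow>
     (\<forall>p\<in>R. \<forall>q\<in>R. (p, q) \<in> {(x, y). x \<in> R \<and> y \<in> R \<and> adjacent x y}\<^sup>*)"

definition is_ribbon :: "cell set \<Rightarrow> cell set \<Rightarrow> bool" where
  "is_ribbon D R \<longleftrightarrow> R \<inter> D = {} \<and> connected_cells R \<and>
     \<not> (\<exists>i j. {(i, j), (Suc i, j), (i, Suc j), (Suc i, Suc j)} \<subseteq> R) \<and>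
     ferrers (D \<union> R)"

text \<open>
  A ribbon runs from its Southwest-most cell \<open>a\<close> to its Northeast-most cell \<open>b\<close>; given \<open>D\<close> there
  is at most one with prescribed \<open>a\<close> and \<open>b\<close>.
\<close>

definition ribbon :: "cell set \<Rightarrow> cell \<Rightarrow> cell \<Rightarrow> cell set" where
  "ribbon D a b = (THE R. is_ribbon D R \<and> a \<in> R \<and> b \<in> R \<and>
     (\<forall>(i, j)\<in>R. fst b \<le> i \<and> i \<le> fst a \<and> snd a \<le> j \<and> j \<le> snd b))"

definition right_of :: "cell \<Rightarrow> cell" where
  "right_of p = (fst p, Suc (snd p))"

definition below :: "cell \<Rightarrow> cell" where
  "below p = (Suc (fst p), snd p)"

definition Insertpoint :: "tableau \<Rightarrow> edge \<Rightarrow> tableau" where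
  "Insertpoint T e =
     (let T' = insert_line T e; s = special_point T in
      if edge_pos (BottomEdge s) < edge_pos e \<or> e = BottomEdge s then T'
      else Tableau
        (cells T' \<union> ribbon (cells T') (right_of (new_point e)) (below (shift_cell e s)))
        (points T'))"

end

theory Submission
  imports Defs
begin

text \<open>
  Insertion factors through the tableaux with a marked pointed corner (a pointed cell that ends both
  its row and its column).  Inserting a line at an edge marks the new point; conversely a marked
  non-root corner is alone in its column or in its row, according to whether it has a point to
  its left or above it, and deleting that line recovers the edge.

  The second step adds the ribbon from the marked corner \<open>p\<close> to the special point \<open>s\<close> of the marked
  tableau (and nothing if \<open>s = p\<close>).  It covers the column bottoms that lie beyond \<open>p\<close>, so that \<open>p\<close> becomes the
  special point.  Conversely, if the special point \<open>p\<close> is not the end of its row, the ribbon to be removed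
  consists of the rim cells strictly between \<open>p\<close> and the first pointed rim cell Northeast of \<open>p\<close>.

  The number of boundary edges is counted by sending each row to its leftmost point and each column
  to its topmost point: every point is hit exactly once, except the root, which is hit twice.
\<close>

section \<open>Ferrers diagrams and contents of cells\<close>

lemma ferrersD: "ferrers D \<Longrightarrow> (i, j) \<in> D \<Longrightarrow> i' \<le> i \<Longrightarrow> j' \<le> j \<Longrightarrow> (i', j') \<in> D"
  unfolding ferrers_def by blast

lemma ferrers_finite: "ferrers D \<Longrightarrow> finite D"
  by (simp add: ferrers_def)

lemma ferrersI:
  assumes "finite D" and up: "\<And>i j. (Suc i, j) \<in> D \<Longrightarrow> (i, j) \<in> D"
    and left: "\<And>i j. (i, Suc j) \<in> D \<Longrightarrow> (i, j) \<in> D"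
  shows "ferrers D"
proof -
  have *: "(i, j + k) \<in> D \<Longrightarrow> (i, j) \<in> D" for i j k
    by (induction k) (auto intro: left)
  have **: "(i + k, j) \<in> D \<Longrightarrow> (i, j) \<in> D" for i j k
    by (induction k) (auto intro: up)
  have "(i', j') \<in> D" if "(i, j) \<in> D" "i' \<le> i" "j' \<le> j" for i j i' j'
    using that * [of i j' "j - j'"] ** [of i' "i - i'" j'] by simp
  then show ?thesis using assms(1) unfolding ferrers_def by blast
qed

text \<open>Constant along diagonals and raised by one by each step East or North, the content
  orders cells along the border. Integers are used because the difference may be negative.\<close>

definition content :: "cell \<Rightarrow> int" where
  "content p = int (snd p) - int (fst p)"

lemma content_pair [simp]: "content (i, j) = int j - int i"
  by (simp add: content_def)

section \<open>Ribbons\<close>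

text \<open>In a Ferrers diagram any cell strictly to the Southeast forces the diagonal neighbour,
  so these are the boundary cells.\<close>

definition rim :: "cell set \<Rightarrow> cell set" where
  "rim D = {(i, j) \<in> D. (Suc i, Suc j) \<notin> D}"

lemma rim_iff [simp]: "(i, j) \<in> rim D \<longleftrightarrow> (i, j) \<in> D \<and> (Suc i, Suc j) \<notin> D"
  by (simp add: rim_def)

text \<open>Neither of two rim cells can lie both strictly below and strictly to the right of the
  other, so the order of their contents settles both coordinates.\<close>

lemma rim_mono:
  assumes "ferrers D" "(i, j) \<in> rim D" "(i', j') \<in> rim D" "int j - int i \<le> int j' - int i'"
  shows "i' \<le> i \<and> j \<le> j'"
proof -
  have "\<not> (Suc i \<le> i' \<and> Suc j \<le> j')" "\<not> (Suc i' \<le> i \<and> Suc j' \<le> j)"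
    using assms ferrersD [OF assms(1)] by auto
  with assms(4) show ?thesis by linarith
qed

text \<open>Follows from \<open>rim_mono\<close> in both directions. Pieces of the rim can thus be
  compared content by content.\<close>

lemma rim_content_inj:
  assumes "ferrers D" "(i, j) \<in> rim D" "(i', j') \<in> rim D" "int j - int i = int j' - int i'"
  shows "i = i' \<and> j = j'"
  using rim_mono [OF assms(1-3)] rim_mono [OF assms(1,3,2)] assms(4) by simp

lemma column_bottom_rim:
  assumes "ferrers D" "(i, j) \<in> D" "(Suc i, j) \<notin> D"
  shows "(i, j) \<in> rim D"
  using assms ferrersD [OF assms(1), of "Suc i" "Suc j" "Suc i" j] by auto

text \<open>
  The ribbon consists of rim cells moved by one step along their diagonals; thus it is cut out
  by a range of contents.
\<close>

definition outer_strip :: "cell set \<Rightarrow> int \<Rightarrow> int \<Rightarrow> cell set" where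
  "outer_strip D k l =
     {(Suc i, Suc j) |i j. (i, j) \<in> rim D \<and> k < int j - int i \<and> int j - int i < l}"

lemma outer_strip_Suc [simp]:
  "(Suc i, Suc j) \<in> outer_strip D k l \<longleftrightarrow>
     (i, j) \<in> D \<and> (Suc i, Suc j) \<notin> D \<and> k < int j - int i \<and> int j - int i < l"
  by (auto simp: outer_strip_def)

lemma outer_strip_0 [simp]: "(0, j) \<notin> outer_strip D k l" "(i, 0) \<notin> outer_strip D k l"
  by (auto simp: outer_strip_def)

lemma outer_stripE:
  assumes "p \<in> outer_strip D k l"
  obtains i j where "p = (Suc i, Suc j)" "(i, j) \<in> D" "(Suc i, Suc j) \<notin> D"
    "k < int j - int i" "int j - int i < l"
  using assms by (auto simp: outer_strip_def)

text \<open>A discrete intermediate value property: adjacent cells differ by one in content, so a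
  path cannot skip a value. It turns connectedness of a ribbon into uniqueness.\<close>

lemma content_between:
  assumes "(a, b) \<in> {(x, y). x \<in> R \<and> y \<in> R \<and> adjacent x y}\<^sup>*" "a \<in> R"
    and "content a \<le> k" "k \<le> content b"
  shows "\<exists>z\<in>R. content z = k"
  using assms
proof (induction arbitrary: k rule: rtrancl_induct)
  case base
  then show ?case by force
next
  case (step y z)
  have "content z \<le> content y + 1"
    using step.hyps by (cases y; cases z) (auto simp: adjacent_def)
  moreover have "z \<in> R" using step.hyps by simp
  \<comment> \<open>Either \<open>k\<close> is at most the content of \<open>y\<close> and the
    induction hypothesis applies, or \<open>k\<close> is the content of \<open>z\<close>.\<close>
  ultimately show ?case using step.IH [of k] step.prems
    by (metis add.commute zless_imp_add1_zle order_antisym not_le order_trans)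
qed

text \<open>
  Here \<open>(r, c)\<close> is the new point, at a corner of \<open>D\<close>, and \<open>(i, j)\<close> is the special point.
\<close>

locale strip =
  fixes D :: "cell set" and r c i j :: nat
  assumes F: "ferrers D"
    and p: "(r, c) \<in> D" "(Suc r, c) \<notin> D" "(r, Suc c) \<notin> D"
    and s: "(i, j) \<in> D" "(Suc i, j) \<notin> D" "c < j"
begin

abbreviation "k \<equiv> int c - int r"
abbreviation "l \<equiv> int j - int i"
abbreviation "R \<equiv> outer_strip D k l"

lemma closed: "(x, y) \<in> D \<Longrightarrow> x' \<le> x \<Longrightarrow> y' \<le> y \<Longrightarrow> (x', y') \<in> D"
  using ferrersD [OF F] .

lemma p_rim: "(r, c) \<in> rim D" and s_rim: "(i, j) \<in> rim D"
  using p s column_bottom_rim [OF F] by blast+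

lemma i_less: "i < r"
  using closed [of i j r "Suc c"] p(3) s by (cases "r \<le> i") auto

text \<open>A cell in column \<open>j\<close> or further right with smaller content than the special
  point lies below row \<open>i\<close>, which would put \<open>(Suc i, j)\<close> into
  \<open>D\<close>.\<close>

lemma before_s:
  assumes "(x, y) \<in> D" "int y - int x < l"
  shows "y < j"
proof (rule ccontr)
  assume "\<not> y < j"
  then show False
    using assms closed [of x y "Suc i" j] s(2) by (cases "Suc i \<le> x") auto
qed

lemma after_p:
  assumes "(x, y) \<in> D" "k < int y - int x"
  shows "x < r"
proof (rule ccontr)
  assume "\<not> x < r"
  then show False
    using assms closed [of x y r "Suc c"] p(3) by (cases "Suc c \<le> y") auto
qed

text \<open>By \<open>rim_mono\<close> the diagonal predecessor lies weakly between
  \<open>(r, c)\<close> and \<open>(i, j)\<close>. The diagonal shift costs one in the bounds by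
  \<open>r\<close> and \<open>j\<close>, which \<open>after_p\<close> and \<open>before_s\<close>
  supply.\<close>

lemma box:
  assumes "(x, y) \<in> R"
  shows "Suc i \<le> x \<and> x \<le> r \<and> Suc c \<le> y \<and> y \<le> j"
proof -
  obtain u v where uv: "x = Suc u" "y = Suc v" "(u, v) \<in> rim D"
    "k < int v - int u" "int v - int u < l"
    using assms by (auto elim!: outer_stripE)
  then show ?thesis
    using rim_mono [OF F uv(3) s_rim] rim_mono [OF F p_rim uv(3)] before_s [of u v] after_p [of u v]
    by auto
qed

text \<open>The cell reached is the diagonal successor of \<open>(x - 1, y)\<close>, a rim cell
  whose content is one larger. That content cannot be \<open>l\<close>, since then
  \<open>(x, y)\<close> would be the missing cell below the special point.\<close>

lemma step_east:
  assumes "(x, y) \<in> D" "(Suc x, Suc y) \<notin> D" "k < int y - int x" "int y - int x < l"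
    and "(x, Suc y) \<notin> D"
  shows "(x, Suc y) \<in> R"
proof (cases x)
  case 0
  then show ?thesis using assms before_s [of x y] closed [of i j x "Suc y"] s by auto
next
  case (Suc u)
  have u: "(u, y) \<in> rim D" using assms closed [of x y u y] Suc by auto
  have "int y - int u \<noteq> l"
    using rim_content_inj [OF F u s_rim] s(2) assms(1) Suc by auto
  then show ?thesis using Suc u assms by auto
qed

text \<open>Mirror image of \<open>step_east\<close>: the content \<open>k\<close> is excluded
  because the cell to the right of \<open>(r, c)\<close> is missing.\<close>

lemma step_south:
  assumes "(x, y) \<in> D" "(Suc x, Suc y) \<notin> D" "k < int y - int x" "int y - int x < l"
    and "(Suc x, y) \<notin> D"
  shows "(Suc x, y) \<in> R"
proof (cases y)
  case 0
  then show ?thesis using assms after_p [of x y] closed [of r c "Suc x" y] p by auto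
next
  case (Suc v)
  have v: "(x, v) \<in> rim D" using assms closed [of x y x v] Suc by auto
  have "int v - int x \<noteq> k"
    using rim_content_inj [OF F v p_rim] p(3) assms(1) Suc by auto
  then show ?thesis using Suc v assms by auto
qed

lemma disjoint: "R \<inter> D = {}"
  by (auto simp: outer_strip_def)

lemma finite_R: "finite R"
proof (rule finite_subset)
  show "R \<subseteq> {..r} \<times> {..j}" using box by auto
qed auto

text \<open>The upper and left neighbours of a strip cell are the right and lower neighbours of its
  diagonal predecessor, so the two step lemmas apply.\<close>

lemma ferrers_Un: "ferrers (D \<union> R)"
proof (rule ferrersI)
  show "finite (D \<union> R)" using ferrers_finite [OF F] finite_R by simp
next
  fix x y assume *: "(Suc x, y) \<in> D \<union> R"
  show "(x, y) \<in> D \<union> R"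
  proof (cases "(Suc x, y) \<in> D")
    case True
    then show ?thesis using closed [of "Suc x" y x y] by simp
  next
    case False
    then have "(Suc x, y) \<in> R" using * by simp
    then obtain v where "y = Suc v" "(x, v) \<in> D" "(Suc x, Suc v) \<notin> D"
      "k < int v - int x" "int v - int x < l"
      by (auto elim: outer_stripE)
    then show ?thesis using step_east [of x v] by auto
  qed
next
  fix x y assume *: "(x, Suc y) \<in> D \<union> R"
  show "(x, y) \<in> D \<union> R"
  proof (cases "(x, Suc y) \<in> D")
    case True
    then show ?thesis using closed [of x "Suc y" x y] by simp
  next
    case False
    then have "(x, Suc y) \<in> R" using * by simp
    then obtain u where "x = Suc u" "(u, y) \<in> D" "(Suc u, Suc y) \<notin> D"
      "k < int y - int u" "int y - int u < l"
      by (auto elim: outer_stripE)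
    then show ?thesis using step_south [of u y] by auto
  qed
qed

lemma start_in: "(r, Suc c) \<in> R"
proof -
  obtain r' where "r = Suc r'" using i_less by (cases r) auto
  then show ?thesis using p i_less s(3) closed [of r c r' c] by auto
qed

lemma end_in: "(Suc i, j) \<in> R"
proof -
  obtain j' where "j = Suc j'" using s(3) by (cases j) auto
  then show ?thesis using s i_less closed [of i j i j'] by auto
qed

text \<open>Walk along the strip: go North if the cell above is outside \<open>D\<close>, otherwise
  East. Both moves stay in the strip, unless the cell above is the special point and the walk is
  over.\<close>

lemma to_end:
  assumes "(x, y) \<in> R"
  shows "((x, y), (Suc i, j)) \<in> {(p, q). p \<in> R \<and> q \<in> R \<and> adjacent p q}\<^sup>*"
    (is "_ \<in> ?S\<^sup>*")
  using assms
proof (induction "x + (j - y)" arbitrary: x y rule: less_induct)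
  case less
  obtain u v where uv: "x = Suc u" "y = Suc v" "(u, v) \<in> D" "(Suc u, Suc v) \<notin> D"
    "k < int v - int u" "int v - int u < l"
    using less.prems by (auto elim!: outer_stripE)
  have bx: "Suc i \<le> x" "y \<le> j" using box [OF less.prems] by auto
  show ?case
  proof (cases "(u, Suc v) \<in> D")
    case False
    then have "(u, y) \<in> R" using step_east [of u v] uv by simp
    moreover have "adjacent (x, y) (u, y)" using uv by (simp add: adjacent_def)
    moreover have "((u, y), (Suc i, j)) \<in> ?S\<^sup>*"
      using less.hyps [of u y] \<open>(u, y) \<in> R\<close> uv by simp
    ultimately show ?thesis using less.prems
      converse_rtrancl_into_rtrancl [of "(x, y)" "(u, y)" ?S] by simp
  next
    case True
    show ?thesis
    proof (cases "int (Suc v) - int u = l")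
      case True
      then have "u = i \<and> Suc v = j"
        using rim_content_inj [OF F _ s_rim, of u "Suc v"] \<open>(u, Suc v) \<in> D\<close> uv
          closed [of "Suc u" "Suc (Suc v)" "Suc u" "Suc v"] by auto
      then show ?thesis using uv by simp
    next
      case False
      then have in_R: "(x, Suc y) \<in> R"
        using uv True closed [of "Suc u" "Suc (Suc v)" "Suc u" "Suc v"] by auto
      \<comment> \<open>This bound makes the truncated difference \<open>j - y\<close> in the
        measure really decrease.\<close>
      then have "Suc y \<le> j" using box by blast
      moreover have "adjacent (x, y) (x, Suc y)" by (simp add: adjacent_def)
      moreover have "((x, Suc y), (Suc i, j)) \<in> ?S\<^sup>*"
        using less.hyps [of x "Suc y"] in_R \<open>Suc y \<le> j\<close> by simp
      ultimately show ?thesis using less.prems in_R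
        converse_rtrancl_into_rtrancl [of "(x, y)" "(x, Suc y)" ?S] by simp
    qed
  qed
qed

lemma connected: "connected_cells R"
  unfolding connected_cells_def
proof (intro ballI)
  let ?S = "{(p, q). p \<in> R \<and> q \<in> R \<and> adjacent p q}"
  fix a b assume "a \<in> R" "b \<in> R"
  then have a: "(a, (Suc i, j)) \<in> ?S\<^sup>*" and b: "(b, (Suc i, j)) \<in> ?S\<^sup>*"
    using to_end by (cases a, cases b, auto)+
  have "sym ?S" by (auto simp: sym_def adjacent_def)
  then have "((Suc i, j), b) \<in> ?S\<^sup>*" using b by (meson sym_rtrancl symD)
  with a show "(a, b) \<in> ?S\<^sup>*" by simp
qed

text \<open>No square fits: a Southeast cell in the strip has its Northwest cell in
  \<open>D\<close>, which is disjoint from the strip.\<close>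

lemma R_is_ribbon: "is_ribbon D R"
  unfolding is_ribbon_def
  using disjoint connected ferrers_Un by auto

text \<open>If the diagonal predecessor were outside \<open>D\<close>, so would be the two cells
  next to both, and \<open>Q\<close> would contain a full square. The bounds on the coordinates give
  the bounds on the content.\<close>

lemma ribbon_subset:
  assumes "is_ribbon D Q" "(x, y) \<in> Q" "Suc i \<le> x" "x \<le> r" "Suc c \<le> y" "y \<le> j"
  shows "(x, y) \<in> R"
proof -
  obtain u v where uv: "x = Suc u" "y = Suc v" using assms by (metis Suc_le_D)
  have cl: "(x', y') \<in> D \<union> Q" if "x' \<le> x" "y' \<le> y" for x' y'
    using that assms(1,2) ferrersD [of "D \<union> Q" x y x' y'] by (simp add: is_ribbon_def)
  have nD: "(x, y) \<notin> D" using assms(1,2) by (auto simp: is_ribbon_def)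
  have "(u, v) \<in> D"
  proof (rule ccontr)
    assume nuv: "(u, v) \<notin> D"
    then have "(u, y) \<notin> D" "(x, v) \<notin> D"
      using closed [of u y u v] closed [of x v u v] uv by auto
    then have "{(u, v), (Suc u, v), (u, Suc v), (Suc u, Suc v)} \<subseteq> Q"
      using cl [of u v] cl [of u y] cl [of x v] uv nuv assms(2) by auto
    then show False using assms(1) unfolding is_ribbon_def by blast
  qed
  then show ?thesis using uv nD assms(3-6) by auto
qed

text \<open>For uniqueness, a competitor \<open>Q\<close> lies inside the strip by
  \<open>ribbon_subset\<close>. Being connected, it attains every content of the strip, and the
  strip has only one cell for each content.\<close>

lemma ribbon_eq: "ribbon D (r, Suc c) (Suc i, j) = R"
  unfolding ribbon_def
proof (rule the_equality)
  show "is_ribbon D R \<and> (r, Suc c) \<in> R \<and> (Suc i, j) \<in> R \<and>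
     (\<forall>(x, y)\<in>R. fst (Suc i, j) \<le> x \<and> x \<le> fst (r, Suc c) \<and> snd (r, Suc c) \<le> y \<and> y \<le> snd (Suc i, j))"
    using R_is_ribbon start_in end_in box by auto
next
  fix Q
  assume Q: "is_ribbon D Q \<and> (r, Suc c) \<in> Q \<and> (Suc i, j) \<in> Q \<and>
     (\<forall>(x, y)\<in>Q. fst (Suc i, j) \<le> x \<and> x \<le> fst (r, Suc c) \<and> snd (r, Suc c) \<le> y \<and> y \<le> snd (Suc i, j))"
  have QR: "Q \<subseteq> R" using Q ribbon_subset by fastforce
  have "R \<subseteq> Q"
  proof
    fix q assume q: "q \<in> R"
    obtain u v where uv: "q = (Suc u, Suc v)" "(u, v) \<in> rim D"
      "k < int v - int u" "int v - int u < l"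
      using q by (auto elim!: outer_stripE)
    have "((r, Suc c), (Suc i, j)) \<in> {(x, y). x \<in> Q \<and> y \<in> Q \<and> adjacent x y}\<^sup>*"
      using Q unfolding is_ribbon_def connected_cells_def by blast
    then obtain z where z: "z \<in> Q" "content z = content q"
      using content_between [of "(r, Suc c)" "(Suc i, j)" Q "content q"] Q uv by auto
    then have "z \<in> R" using QR by blast
    then obtain u' v' where uv': "z = (Suc u', Suc v')" "(u', v') \<in> rim D"
      by (auto elim!: outer_stripE)
    then have "z = q" using rim_content_inj [OF F uv'(2) uv(2)] z(2) uv by auto
    then show "q \<in> Q" using z by simp
  qed
  with QR show "Q = R" by blast
qed

text \<open>With \<open>column_exists\<close>, this shows that the ribbon creates no new row or
  column, so none without a point.\<close>

lemma row_exists: "(x, y) \<in> R \<Longrightarrow> (x, 0) \<in> D"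
  using box [of x y] closed [of r c x 0] p(1) by auto

lemma column_exists: "(x, y) \<in> R \<Longrightarrow> (0, y) \<in> D"
  using box [of x y] closed [of i j 0 y] s(1) by auto

text \<open>Cells of \<open>D\<close> in this content range leave the rim when their diagonal
  successors are added. The ribbon can therefore be read off from the enlarged diagram.\<close>

lemma rim_Un: "{q \<in> rim (D \<union> R). k < content q \<and> content q < l} = R"
proof (intro equalityI subsetI)
  fix q assume q: "q \<in> R"
  then obtain x y where xy: "q = (Suc x, Suc y)" "(Suc x, Suc y) \<notin> D"
      "k < int y - int x" "int y - int x < l"
    by (auto elim!: outer_stripE)
  then show "q \<in> {q \<in> rim (D \<union> R). k < content q \<and> content q < l}"
    using q closed [of "Suc (Suc x)" "Suc (Suc y)" "Suc x" "Suc y"] by auto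
next
  fix q assume "q \<in> {q \<in> rim (D \<union> R). k < content q \<and> content q < l}"
  then show "q \<in> R" by (cases q) auto
qed

lemma s_rim_Un: "(i, j) \<in> rim (D \<union> R)"
  using s s_rim box [of "Suc i" "Suc j"] by auto

lemma p_bottom_Un: "(Suc r, c) \<notin> D \<union> R"
  using p box [of "Suc r" c] by auto

text \<open>The cell below \<open>(u, v)\<close> is the diagonal successor of
  \<open>(u, v - 1)\<close>, whose content lies in the range because \<open>i \<le> u < r\<close>
  and \<open>c < v \<le> j\<close>.\<close>

lemma column_bottom_covered:
  assumes "(u, v) \<in> D" "(Suc u, v) \<notin> D" "c < v" "v \<le> j"
  shows "(Suc u, v) \<in> R"
proof -
  obtain v' where v: "v = Suc v'" using assms(3) by (cases v) auto
  have uv: "(u, v) \<in> rim D" using column_bottom_rim [OF F assms(1,2)] .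
  have "u < r" using closed [OF assms(1), of r "Suc c"] p(3) assms(3) by (cases "r \<le> u") auto
  moreover have "i \<le> u"
    using closed [OF s(1), of "Suc u" v] assms(2,4) by (cases "i \<le> u") auto
  moreover have "(u, v') \<in> D" using closed [OF assms(1), of u v'] v by simp
  ultimately show ?thesis using assms v by auto
qed

end

text \<open>
  The situation after the ribbon has been added: \<open>(r, c)\<close> is the special point, and \<open>(i, j)\<close> is the
  first pointed rim cell to its Northeast.
\<close>

locale inner_strip =
  fixes D :: "cell set" and r c i j :: nat
  assumes F: "ferrers D"
    and p: "(r, c) \<in> D" "(Suc r, c) \<notin> D" "(r, Suc c) \<in> D"
    and s: "(i, j) \<in> D" "(Suc i, Suc j) \<notin> D" "(Suc i, j) \<in> D" "c < j"
begin

abbreviation "k \<equiv> int c - int r"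
abbreviation "l \<equiv> int j - int i"
abbreviation "R \<equiv> {q \<in> rim D. k < content q \<and> content q < l}"

lemma closed: "(x, y) \<in> D \<Longrightarrow> x' \<le> x \<Longrightarrow> y' \<le> y \<Longrightarrow> (x', y') \<in> D"
  using ferrersD [OF F] .

lemma p_rim: "(r, c) \<in> rim D" and s_rim: "(i, j) \<in> rim D"
  using p s column_bottom_rim [OF F] by (blast, simp)

lemma i_less: "i < r"
  using closed [of "Suc i" j "Suc r" c] p s by (cases "r \<le> i") auto

text \<open>\<open>rim_mono\<close> gives the weak bounds. Row \<open>i\<close> and column
  \<open>c\<close> are excluded because \<open>(Suc i, j)\<close> and \<open>(r, Suc c)\<close> are
  in \<open>D\<close>, so a cell there would have its diagonal neighbour in
  \<open>D\<close>.\<close>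

lemma box:
  assumes "(x, y) \<in> R"
  shows "Suc i \<le> x \<and> x \<le> r \<and> Suc c \<le> y \<and> y \<le> j"
proof -
  have xy: "(x, y) \<in> rim D" "k < int y - int x" "int y - int x < l" using assms by auto
  have "i \<le> x" "x \<le> r" "c \<le> y" "y \<le> j"
    using rim_mono [OF F xy(1) s_rim] rim_mono [OF F p_rim xy(1)] xy by auto
  moreover have "x \<noteq> i" using closed [OF s(3), of "Suc i" "Suc y"] xy by auto
  moreover have "y \<noteq> c" using closed [OF p(3), of "Suc x" "Suc c"] xy by auto
  ultimately show ?thesis by auto
qed

text \<open>The lower neighbour is again on the rim with content one less. It cannot be
  \<open>(r, c)\<close>, since \<open>(r, Suc c)\<close> would then be a diagonal neighbour of
  \<open>(x, y)\<close> in \<open>D\<close>.\<close>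

lemma step_south:
  assumes "(x, y) \<in> R" "(Suc x, y) \<in> D"
  shows "(Suc x, y) \<in> R"
proof -
  have *: "(Suc x, y) \<in> rim D" using assms closed [of "Suc (Suc x)" "Suc y" "Suc x" "Suc y"] by auto
  have "int y - int (Suc x) \<noteq> k"
    using rim_content_inj [OF F * p_rim] p assms by auto
  then show ?thesis using * assms by auto
qed

lemma step_east:
  assumes "(x, y) \<in> R" "(x, Suc y) \<in> D"
  shows "(x, Suc y) \<in> R"
proof -
  have *: "(x, Suc y) \<in> rim D" using assms closed [of "Suc x" "Suc (Suc y)" "Suc x" "Suc y"] by auto
  have "int (Suc y) - int x \<noteq> l"
    using rim_content_inj [OF F * s_rim] s assms by auto
  then show ?thesis using * assms by auto
qed

lemma ferrers_Diff: "ferrers (D - R)"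
proof (rule ferrersI)
  show "finite (D - R)" using ferrers_finite [OF F] by simp
next
  fix x y assume "(Suc x, y) \<in> D - R"
  then show "(x, y) \<in> D - R" using step_south [of x y] closed [of "Suc x" y x y] by auto
next
  fix x y assume "(x, Suc y) \<in> D - R"
  then show "(x, y) \<in> D - R" using step_east [of x y] closed [of x "Suc y" x y] by auto
qed

lemma start_in: "(r, Suc c) \<in> R"
  using p i_less s(4) closed [of "Suc r" "Suc (Suc c)" "Suc r" c] by auto

lemma end_in: "(Suc i, j) \<in> R"
  using i_less s closed [of "Suc (Suc i)" "Suc j" "Suc i" "Suc j"] by auto

text \<open>Removing the ribbon exposes exactly the diagonal predecessors of its cells: they are in
  \<open>D\<close> but not on its rim, hence are not removed themselves.\<close>

lemma outer_strip_Diff: "outer_strip (D - R) k l = R"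
proof (intro equalityI subsetI)
  fix q assume "q \<in> outer_strip (D - R) k l"
  then show "q \<in> R" by (auto elim!: outer_stripE)
next
  fix q assume q: "q \<in> R"
  obtain x' y' where "q = (x', y')" by fastforce
  with q box [of x' y'] obtain x y where xy: "q = (Suc x, Suc y)" by (auto dest!: Suc_le_D)
  then show "q \<in> outer_strip (D - R) k l"
    using q closed [of "Suc x" "Suc y" x y] by auto
qed

end

section \<open>Special points and corners\<close>

lemma tree_like_ferrers: "tree_like T \<Longrightarrow> ferrers (cells T)"
  and tree_like_points: "tree_like T \<Longrightarrow> points T \<subseteq> cells T"
  and tree_like_root: "tree_like T \<Longrightarrow> (0, 0) \<in> points T"
  by (simp_all add: tree_like_def)

lemma tree_like_above_left:
  assumes "tree_like T" "(i, j) \<in> points T" "(i, j) \<noteq> (0, 0)"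
  shows "(\<exists>i'<i. (i', j) \<in> points T) \<noteq> (\<exists>j'<j. (i, j') \<in> points T)"
proof -
  have "\<forall>(i, j)\<in>points T. (i, j) \<noteq> (0, 0) \<longrightarrow>
        (\<exists>i'<i. (i', j) \<in> points T) \<noteq> (\<exists>j'<j. (i, j') \<in> points T)"
    using assms(1) unfolding tree_like_def by (elim conjE)
  from bspec [OF this assms(2), unfolded case_prod_conv] show ?thesis using assms(3) by (rule mp)
qed

lemma tree_like_row: "tree_like T \<Longrightarrow> (i, j) \<in> cells T \<Longrightarrow> \<exists>j'. (i, j') \<in> points T"
  and tree_like_column: "tree_like T \<Longrightarrow> (i, j) \<in> cells T \<Longrightarrow> \<exists>i'. (i', j) \<in> points T"
proof -
  assume T: "tree_like T" and ij: "(i, j) \<in> cells T"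
  have "\<forall>(i, j)\<in>cells T. (\<exists>j'. (i, j') \<in> points T) \<and> (\<exists>i'. (i', j) \<in> points T)"
    using T unfolding tree_like_def by (elim conjE)
  from bspec [OF this ij, unfolded case_prod_conv]
  show "\<exists>j'. (i, j') \<in> points T" "\<exists>i'. (i', j) \<in> points T" by simp_all
qed

lemma tree_likeI:
  assumes "ferrers (cells T)" "points T \<subseteq> cells T" "(0, 0) \<in> points T"
    and "\<And>i j. (i, j) \<in> points T \<Longrightarrow> (i, j) \<noteq> (0, 0) \<Longrightarrow>
      (\<exists>i'<i. (i', j) \<in> points T) \<noteq> (\<exists>j'<j. (i, j') \<in> points T)"
    and "\<And>i j. (i, j) \<in> cells T \<Longrightarrow> \<exists>j'. (i, j') \<in> points T"
    and "\<And>i j. (i, j) \<in> cells T \<Longrightarrow> \<exists>i'. (i', j) \<in> points T"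
  shows "tree_like T"
proof -
  have "\<forall>(i, j)\<in>points T. (i, j) \<noteq> (0, 0) \<longrightarrow>
        (\<exists>i'<i. (i', j) \<in> points T) \<noteq> (\<exists>j'<j. (i, j') \<in> points T)"
    by (rule ballI, unfold split_paired_all case_prod_conv, rule impI, rule assms(4))
  moreover have "\<forall>(i, j)\<in>cells T. (\<exists>j'. (i, j') \<in> points T) \<and> (\<exists>i'. (i', j) \<in> points T)"
    by (rule ballI, unfold split_paired_all case_prod_conv) (intro conjI assms(5,6))
  ultimately show ?thesis unfolding tree_like_def using assms(1-3) by (intro conjI)
qed

text \<open>The condition on points above and to the left does not mention cells, so a change of
  shape that creates no row or column preserves it.\<close>

lemma tree_like_change_cells:
  assumes "tree_like T" "ferrers D" "points T \<subseteq> D"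
    and "\<And>i j. (i, j) \<in> D \<Longrightarrow> (i, 0) \<in> cells T" "\<And>i j. (i, j) \<in> D \<Longrightarrow> (0, j) \<in> cells T"
  shows "tree_like (Tableau D (points T))"
proof (rule tree_likeI; unfold tableau.sel)
  fix i j
  show "(\<exists>i'<i. (i', j) \<in> points T) \<noteq> (\<exists>j'<j. (i, j') \<in> points T)"
    if "(i, j) \<in> points T" "(i, j) \<noteq> (0, 0)"
    using tree_like_above_left [OF assms(1) that] .
  show "\<exists>j'. (i, j') \<in> points T" if "(i, j) \<in> D"
    using tree_like_row [OF assms(1) assms(4) [OF that]] .
  show "\<exists>i'. (i', j) \<in> points T" if "(i, j) \<in> D"
    using tree_like_column [OF assms(1) assms(5) [OF that]] .
qed (use assms(2,3) tree_like_root [OF assms(1)] in simp_all)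

definition is_special :: "tableau \<Rightarrow> cell \<Rightarrow> bool" where
  "is_special T p \<longleftrightarrow>
     p \<in> column_bottom_points T \<and> (\<forall>q\<in>column_bottom_points T. snd q \<le> snd p)"

lemma column_bottom_unique:
  assumes "ferrers D" "(i, j) \<in> D" "(Suc i, j) \<notin> D" "(i', j) \<in> D" "(Suc i', j) \<notin> D"
  shows "i = i'"
  using assms ferrersD [OF assms(1,2), of "Suc i'" j] ferrersD [OF assms(1,4), of "Suc i" j]
  by (cases i i' rule: linorder_cases) auto

lemma is_special_unique:
  assumes "tree_like T" "is_special T p" "is_special T q"
  shows "p = q"
proof (cases p; cases q)
  fix i j i' j' assume pq: "p = (i, j)" "q = (i', j')"
  then have "j = j'" using assms(2,3) unfolding is_special_def by (metis le_antisym snd_conv)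
  then show "p = q"
    using pq assms column_bottom_unique [OF tree_like_ferrers [OF assms(1)], of i j i']
      tree_like_points [OF assms(1)]
    unfolding is_special_def column_bottom_points_def by auto
qed

lemma special_point_eqI: "tree_like T \<Longrightarrow> is_special T p \<Longrightarrow> special_point T = p"
  unfolding special_point_def is_special_def [symmetric]
  by (rule the_equality) (simp_all add: is_special_unique)

text \<open>Any point in the last row is the bottom of its column, so there are candidates;
  finiteness yields a rightmost one.\<close>

lemma special_point:
  assumes "tree_like T"
  shows "is_special T (special_point T)"
proof -
  let ?C = "column_bottom_points T"
  have F: "ferrers (cells T)" using tree_like_ferrers [OF assms] .
  have fin: "finite ?C"
    using tree_like_points [OF assms] ferrers_finite [OF F]
    by (auto simp: column_bottom_points_def intro: finite_subset)
  let ?I = "fst ` cells T"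
  have "(0, 0) \<in> cells T" using tree_like_root tree_like_points assms by blast
  then have "Max ?I \<in> ?I" using ferrers_finite [OF F] by (intro Max_in) auto
  then obtain j where ij: "(Max ?I, j) \<in> cells T" by force
  have last: "(Suc (Max ?I), j') \<notin> cells T" for j'
  proof
    assume "(Suc (Max ?I), j') \<in> cells T"
    then have "Suc (Max ?I) \<in> ?I" by (metis fst_conv image_eqI)
    then have "Suc (Max ?I) \<le> Max ?I" using ferrers_finite [OF F] by (intro Max_ge) auto
    then show False by simp
  qed
  then have "?C \<noteq> {}"
    using tree_like_row [OF assms ij] unfolding column_bottom_points_def by blast
  then have "Max (snd ` ?C) \<in> snd ` ?C" using fin by (intro Max_in) auto
  then obtain p where "p \<in> ?C" "snd p = Max (snd ` ?C)" by force
  then have "p \<in> ?C" "\<forall>q\<in>?C. snd q \<le> snd p" using fin by auto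
  then have "is_special T p" by (simp add: is_special_def)
  then show ?thesis using special_point_eqI [OF assms] by simp
qed

section \<open>Adding a ribbon to a tableau with a marked corner, and removing it\<close>

definition corner :: "tableau \<Rightarrow> cell \<Rightarrow> bool" where
  "corner T p \<longleftrightarrow> p \<in> points T \<and> right_of p \<notin> cells T \<and> below p \<notin> cells T"

definition add_ribbon :: "tableau \<times> cell \<Rightarrow> tableau" where
  "add_ribbon = (\<lambda>(T, p). if special_point T = p then T else
     Tableau (cells T \<union> outer_strip (cells T) (content p) (content (special_point T))) (points T))"

lemma points_add_ribbon [simp]: "points (add_ribbon (T, p)) = points T"
  by (simp add: add_ribbon_def)

text \<open>A pointed corner is itself a pointed column bottom, so the special point is in its
  column or further right; the same column would mean the same cell.\<close>

lemma strip_special: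
  assumes "tree_like T" "corner T (r, c)" "special_point T = (i, j)" "(i, j) \<noteq> (r, c)"
  shows "strip (cells T) r c i j"
proof -
  note F = tree_like_ferrers [OF assms(1)]
  have sp: "is_special T (i, j)" using special_point [OF assms(1)] assms(3) by simp
  have p: "(r, c) \<in> cells T" "(Suc r, c) \<notin> cells T" "(r, Suc c) \<notin> cells T"
    using assms(2) tree_like_points [OF assms(1)] by (auto simp: corner_def right_of_def below_def)
  have s: "(i, j) \<in> cells T" "(Suc i, j) \<notin> cells T"
    using sp tree_like_points [OF assms(1)] by (auto simp: is_special_def column_bottom_points_def)
  have "(r, c) \<in> column_bottom_points T"
    using assms(2) by (auto simp: corner_def below_def column_bottom_points_def)
  then have "c \<le> j" using sp by (auto simp: is_special_def)
  moreover have "c \<noteq> j" using column_bottom_unique [OF F s, of r] p assms(4) by auto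
  ultimately show ?thesis using F p s by unfold_locales auto
qed

lemma add_ribbon_special: "special_point T = p \<Longrightarrow> add_ribbon (T, p) = T"
  by (simp add: add_ribbon_def)

text \<open>The ribbon covers the bottoms of the columns after \<open>c\<close> up to that of the
  old special point, and no pointed bottom existed beyond.\<close>

lemma add_ribbon_corner:
  assumes "tree_like T" "corner T p"
  shows "tree_like (add_ribbon (T, p)) \<and> is_special (add_ribbon (T, p)) p"
proof (cases "special_point T = p")
  case True
  then show ?thesis using special_point assms by (auto simp: add_ribbon_special)
next
  case False
  obtain r c i j where pq: "p = (r, c)" "special_point T = (i, j)" by fastforce
  interpret strip "cells T" r c i j
    using strip_special assms pq False by auto
  have eq: "add_ribbon (T, p) = Tableau (cells T \<union> R) (points T)"
    using False pq by (auto simp: add_ribbon_def)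
  have "tree_like (Tableau (cells T \<union> R) (points T))"
    using tree_like_points [OF assms(1)] row_exists column_exists closed
    by (intro tree_like_change_cells assms ferrers_Un) blast+
  moreover have "is_special (Tableau (cells T \<union> R) (points T)) p"
  proof -
    have "v \<le> c" if q: "(u, v) \<in> points T" "(Suc u, v) \<notin> cells T \<union> R" for u v
    proof -
      have "(u, v) \<in> column_bottom_points T" using q by (auto simp: column_bottom_points_def)
      then have "v \<le> j" using special_point [OF assms(1)] pq by (auto simp: is_special_def)
      then show ?thesis
        using column_bottom_covered [of u v] q tree_like_points [OF assms(1)] by force
    qed
    then show ?thesis
      using assms(2) p_bottom_Un pq
      by (auto simp: is_special_def column_bottom_points_def corner_def)
  qed
  ultimately show ?thesis by (simp add: eq)
qed

text \<open>
  Since the ribbon contains no points, the cell following it is determined by the new tableau.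
\<close>

definition strip_end :: "tableau \<Rightarrow> cell \<Rightarrow> cell \<Rightarrow> bool" where
  "strip_end T p s \<longleftrightarrow> s \<in> points T \<inter> rim (cells T) \<and> content p < content s \<and>
     (\<forall>q\<in>points T \<inter> rim (cells T). content p < content q \<longrightarrow> content s \<le> content q)"

text \<open>The cell to the right of \<open>p\<close> reveals whether a ribbon was added. If so, the
  old special point is the first pointed rim cell after \<open>p\<close> and fixes the content range
  to be removed.\<close>

lemma add_ribbon_inverse:
  assumes "tree_like T" "corner T p" and U: "U = add_ribbon (T, p)"
  shows "(if right_of p \<in> cells U then \<exists>s. strip_end U p s \<and> cells T = cells U -
      {q \<in> rim (cells U). content p < content q \<and> content q < content s} else T = U)"
proof (cases "special_point T = p")
  case True
  then have "U = T" using U by (simp add: add_ribbon_special)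
  then show ?thesis using assms(2) by (simp add: corner_def)
next
  case False
  obtain r c i j where pq: "p = (r, c)" "special_point T = (i, j)" by fastforce
  interpret strip "cells T" r c i j
    using strip_special assms pq False by auto
  have eq: "U = Tableau (cells T \<union> R) (points T)"
    using False pq U by (auto simp: add_ribbon_def)
  have "right_of p \<in> cells U" using start_in pq by (simp add: eq right_of_def)
  moreover have "strip_end U p (i, j)"
    unfolding strip_end_def
  proof (intro conjI ballI impI)
    show "(i, j) \<in> points U \<inter> rim (cells U)"
      using s_rim_Un special_point [OF assms(1)] pq
      by (auto simp: eq is_special_def column_bottom_points_def)
    show "content p < content (i, j)" using pq i_less s(3) by simp
    \<comment> \<open>New cells are empty, so \<open>q\<close> is outside the ribbon, which fills
      the rim between \<open>p\<close> and the old special point by \<open>rim_Un\<close>.\<close>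
    fix q assume q: "q \<in> points U \<inter> rim (cells U)" "content p < content q"
    then have "q \<in> cells T" using tree_like_points [OF assms(1)] by (auto simp: eq)
    then have "q \<notin> R" using disjoint by blast
    then show "content (i, j) \<le> content q"
      using q rim_Un pq unfolding eq by force
  qed
  moreover have "cells T = cells U -
      {q \<in> rim (cells U). content p < content q \<and> content q < content (i, j)}"
    using rim_Un disjoint pq by (auto simp: eq)
  ultimately show ?thesis by auto
qed

text \<open>The preimage is obtained by cutting the rim between \<open>p\<close> and the next
  pointed rim cell; \<open>inner_strip\<close> shows that adding the ribbon undoes the cut.\<close>

lemma add_ribbon_surj:
  assumes T: "tree_like T" and p: "is_special T p"
  shows "\<exists>T'. tree_like T' \<and> corner T' p \<and> add_ribbon (T', p) = T"
proof (cases "right_of p \<in> cells T")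
  case False
  then have "corner T p"
    using p unfolding is_special_def
    by (cases p) (simp add: corner_def column_bottom_points_def below_def)
  moreover have "add_ribbon (T, p) = T"
    using special_point_eqI [OF T p] by (rule add_ribbon_special)
  ultimately show ?thesis using T by blast
next
  case True
  note F = tree_like_ferrers [OF T]
  obtain r c where rc: "p = (r, c)" by fastforce
  have p': "(r, c) \<in> points T" "(r, c) \<in> cells T" "(Suc r, c) \<notin> cells T" "(r, Suc c) \<in> cells T"
    using True rc p tree_like_points [OF T]
    by (auto simp: is_special_def column_bottom_points_def right_of_def)
  have max: "v \<le> c" if "(u, v) \<in> points T" "(Suc u, v) \<notin> cells T" for u v
    using that p rc by (auto simp: is_special_def column_bottom_points_def)
  let ?P = "\<lambda>q. q \<in> points T \<inter> rim (cells T) \<and> content p < content q"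
  \<comment> \<open>Any point in the last column \<open>m\<close> is on the rim and lies Northeast
    of \<open>p\<close>, so there is a pointed rim cell to choose from.\<close>
  define m where "m = Max (snd ` cells T)"
  have fin: "finite (snd ` cells T)" using ferrers_finite [OF F] by simp
  have m: "c < m" using Max_ge [OF fin, of "Suc c"] p'(4) unfolding m_def by force
  have "m \<in> snd ` cells T" unfolding m_def using Max_in [OF fin] p'(2) by blast
  then obtain x where x: "(x, m) \<in> points T" using tree_like_column [OF T] by fastforce
  have "(Suc x, Suc m) \<notin> cells T" using Max_ge [OF fin, of "Suc m"] unfolding m_def by force
  moreover have "x \<le> r"
    using ferrersD [OF F, of x m "Suc r" c] x tree_like_points [OF T] m p'
    by (cases "x \<le> r") auto
  ultimately have "?P (x, m)" using x m tree_like_points [OF T] rc by auto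
  \<comment> \<open>Contents of cells satisfying \<open>?P\<close> exceed that of \<open>p\<close>,
    so passing to natural numbers preserves their order.\<close>
  then obtain s where least: "?P s" "\<And>q. ?P q \<Longrightarrow> nat (content s - content p) \<le> nat (content q - content p)"
    using ex_has_least_nat [of ?P "(x, m)" "\<lambda>q. nat (content q - content p)"] by auto
  obtain i j where ij: "s = (i, j)" by fastforce
  have s': "(i, j) \<in> points T" "(i, j) \<in> rim (cells T)" "int c - int r < int j - int i"
    using least(1) ij rc by auto
  have p_rim: "(r, c) \<in> rim (cells T)" using column_bottom_rim [OF F] p' by blast
  have "i \<le> r" "c \<le> j" using rim_mono [OF F p_rim s'(2)] s'(3) by auto
  moreover have "j \<noteq> c"
    using ferrersD [OF F p'(4), of "Suc i" "Suc c"] s' by auto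
  ultimately have "c < j" by simp
  \<comment> \<open>As \<open>p\<close> is special, the point \<open>s\<close> further right is not
    a column bottom.\<close>
  then have "(Suc i, j) \<in> cells T" using max [of i j] s' by force
  then interpret inner_strip "cells T" r c i j
    using F p' s' \<open>c < j\<close> by unfold_locales auto
  define T' where "T' = Tableau (cells T - R) (points T)"
  have "points T \<inter> R = {}"
    using least(2) s'(3) ij rc by force
  then have tl: "tree_like T'"
    unfolding T'_def using tree_like_points [OF T] closed
    by (intro tree_like_change_cells T ferrers_Diff) blast+
  have co: "corner T' p"
    using start_in p' by (simp add: corner_def T'_def rc right_of_def below_def)
  have "is_special T' s"
  proof -
    \<comment> \<open>Such a point either was a column bottom already, so \<open>v \<le> c\<close>,
      or lies above a removed cell, whose column is bounded by \<open>box\<close>.\<close>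
    have "v \<le> j" if "(u, v) \<in> points T" "(Suc u, v) \<notin> cells T - R" for u v
      using that max [of u v] \<open>c < j\<close> box [of "Suc u" v] by force
    then show ?thesis
      using s' end_in ij by (auto simp: is_special_def column_bottom_points_def T'_def)
  qed
  then have "special_point T' = (i, j)" using special_point_eqI [OF tl] ij by simp
  then have "add_ribbon (T', p) = Tableau (cells T' \<union> outer_strip (cells T') k l) (points T')"
    using \<open>c < j\<close> rc by (simp add: add_ribbon_def)
  also have "\<dots> = Tableau ((cells T - R) \<union> R) (points T)"
    by (simp only: T'_def tableau.sel outer_strip_Diff)
  also have "(cells T - R) \<union> R = cells T" by auto
  finally show ?thesis using tl co by auto
qed

definition corner_tableaux :: "nat \<Rightarrow> (tableau \<times> cell) set" where
  "corner_tableaux n = {(T, p). T \<in> TLT n \<and> corner T p}"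

text \<open>The mark is recovered as the special point of the image, and then the shape through
  \<open>add_ribbon_inverse\<close>; the points never change.\<close>

lemma bij_betw_add_ribbon: "bij_betw add_ribbon (corner_tableaux n) (TLT n)"
proof (rule bij_betw_imageI)
  show "inj_on add_ribbon (corner_tableaux n)"
  proof (rule inj_onI, clarify)
    fix T p T' p'
    assume A: "(T, p) \<in> corner_tableaux n" "(T', p') \<in> corner_tableaux n"
      and eq: "add_ribbon (T, p) = add_ribbon (T', p')"
    have tl: "tree_like T" "corner T p" "tree_like T'" "corner T' p'"
      using A by (auto simp: corner_tableaux_def TLT_def)
    define U where "U = add_ribbon (T, p)"
    have U': "U = add_ribbon (T', p')" using eq U_def by simp
    have pp: "p = p'"
      using add_ribbon_corner [OF tl(1,2)] add_ribbon_corner [OF tl(3,4)] eq is_special_unique by metis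
    have "points T = points T'" using eq points_add_ribbon by metis
    moreover have "cells T = cells T'"
    proof (cases "right_of p \<in> cells U")
      case False
      then show ?thesis
        using add_ribbon_inverse [OF tl(1,2) U_def] add_ribbon_inverse [OF tl(3,4) U'] pp by simp
    next
      case True
      obtain s where s: "strip_end U p s" "cells T = cells U -
          {q \<in> rim (cells U). content p < content q \<and> content q < content s}"
        using add_ribbon_inverse [OF tl(1,2) U_def] True by auto
      obtain s' where s': "strip_end U p s'" "cells T' = cells U -
          {q \<in> rim (cells U). content p < content q \<and> content q < content s'}"
        using add_ribbon_inverse [OF tl(3,4) U'] True pp by auto
      \<comment> \<open>Minimality fixes the content of the strip end, and the removed set depends
        on this content alone.\<close>
      have "content s = content s'" using s(1) s'(1) unfolding strip_end_def by (meson order_antisym)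
      then show ?thesis using s(2) s'(2) by simp
    qed
    ultimately show "T = T' \<and> p = p'" using pp by (simp add: tableau.expand)
  qed
  show "add_ribbon ` corner_tableaux n = TLT n"
  proof (intro equalityI subsetI)
    fix U assume "U \<in> add_ribbon ` corner_tableaux n"
    then show "U \<in> TLT n" using add_ribbon_corner by (auto simp: corner_tableaux_def TLT_def)
  next
    fix U assume "U \<in> TLT n"
    then have U: "tree_like U" "card (points U) = n" by (auto simp: TLT_def)
    obtain T where T: "tree_like T" "corner T (special_point U)" "add_ribbon (T, special_point U) = U"
      using add_ribbon_surj [OF U(1) special_point [OF U(1)]] by blast
    then have "points T = points U" using points_add_ribbon by metis
    then show "U \<in> add_ribbon ` corner_tableaux n"
      using T U by (auto simp: corner_tableaux_def TLT_def intro!: image_eqI [of _ _ "(T, special_point U)"])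
  qed
qed

section \<open>Insertion of lines\<close>

fun flip_edge :: "edge \<Rightarrow> edge" where
  "flip_edge (RightEdge p) = BottomEdge (prod.swap p)"
| "flip_edge (BottomEdge p) = RightEdge (prod.swap p)"

definition flip :: "tableau \<Rightarrow> tableau" where
  "flip T = Tableau (prod.swap ` cells T) (prod.swap ` points T)"

lemma flip_flip [simp]: "flip (flip T) = T"
  by (simp add: flip_def image_image)

lemma flip_cells [simp]: "(i, j) \<in> cells (flip T) \<longleftrightarrow> (j, i) \<in> cells T"
  and flip_points [simp]: "(i, j) \<in> points (flip T) \<longleftrightarrow> (j, i) \<in> points T"
  by (simp_all add: flip_def)

lemma card_points_flip [simp]: "card (points (flip T)) = card (points T)"
  by (simp add: flip_def card_image)

lemma tree_like_flipI:
  assumes "tree_like T"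
  shows "tree_like (flip T)"
proof (rule tree_likeI)
  note F = tree_like_ferrers [OF assms]
  show "ferrers (cells (flip T))"
  proof (rule ferrersI)
    show "finite (cells (flip T))" using ferrers_finite [OF F] by (simp add: flip_def)
  qed (use F in \<open>auto elim: ferrersD\<close>)
  show "points (flip T) \<subseteq> cells (flip T)" using tree_like_points [OF assms] by (auto simp: flip_def)
  show "(0, 0) \<in> points (flip T)" using tree_like_root [OF assms] by simp
  fix i j
  show "(\<exists>i'<i. (i', j) \<in> points (flip T)) \<noteq> (\<exists>j'<j. (i, j') \<in> points (flip T))"
    if "(i, j) \<in> points (flip T)" "(i, j) \<noteq> (0, 0)"
    using tree_like_above_left [OF assms, of j i] that by auto
  show "\<exists>j'. (i, j') \<in> points (flip T)" "\<exists>i'. (i', j) \<in> points (flip T)"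
    if "(i, j) \<in> cells (flip T)"
    using tree_like_row [OF assms, of j i] tree_like_column [OF assms, of j i] that by simp_all
qed

lemma tree_like_flip [simp]: "tree_like (flip T) \<longleftrightarrow> tree_like T"
  using tree_like_flipI [of T] tree_like_flipI [of "flip T"] by auto

lemma corner_flip [simp]: "corner (flip T) (i, j) \<longleftrightarrow> corner T (j, i)"
  by (auto simp: corner_def right_of_def below_def)

lemma shift_cell_flip: "shift_cell (flip_edge e) (prod.swap p) = prod.swap (shift_cell e p)"
  by (cases e; cases p) auto

lemma new_cells_flip: "new_cells (flip_edge e) = prod.swap ` new_cells e"
  by (cases e) (auto simp: image_iff)

lemma new_point_flip: "new_point (flip_edge e) = prod.swap (new_point e)"
  by (cases e) auto

lemma insert_line_flip: "insert_line (flip T) (flip_edge e) = flip (insert_line T e)"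
  by (simp add: insert_line_def flip_def image_Un image_image shift_cell_flip
      new_cells_flip new_point_flip)

section \<open>Column insertion\<close>

lemma shift_column_image:
  "(x, y) \<in> shift_cell (RightEdge (r, c)) ` A \<longleftrightarrow>
    (if y \<le> c then (x, y) \<in> A else y \<noteq> Suc c \<and> (x, y - 1) \<in> A)"
    (is "?L \<longleftrightarrow> ?R")
proof
  show "?L \<Longrightarrow> ?R" by (auto split: if_splits)
  show "?R \<Longrightarrow> ?L"
    by (rule image_eqI [of _ _ "(x, if y \<le> c then y else y - 1)"]) (auto split: if_splits)
qed

lemma insert_column_cells:
  "(x, y) \<in> cells (insert_line T (RightEdge (r, c))) \<longleftrightarrow>
    (if y \<le> c then (x, y) \<in> cells T else if y = Suc c then x \<le> r else (x, y - 1) \<in> cells T)"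
  by (auto simp: insert_line_def shift_column_image simp del: shift_cell.simps)

lemma insert_column_points:
  "(x, y) \<in> points (insert_line T (RightEdge (r, c))) \<longleftrightarrow>
    (if y \<le> c then (x, y) \<in> points T else if y = Suc c then x = r else (x, y - 1) \<in> points T)"
  by (auto simp: insert_line_def shift_column_image simp del: shift_cell.simps)

text \<open>The new point is alone in its column and row \<open>r\<close> already has a point to its
  left. The other points keep their relations, since those moved East lie above row \<open>r\<close>
  and do not see the new point.\<close>

lemma insert_column:
  assumes T: "tree_like T" and e: "(r, c) \<in> cells T" "(r, Suc c) \<notin> cells T"
    and U: "U = insert_line T (RightEdge (r, c))"
  shows "tree_like U \<and> corner U (r, Suc c) \<and> (\<exists>j<Suc c. (r, j) \<in> points U)"
proof -
  note F = tree_like_ferrers [OF T]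
  note closed = ferrersD [OF F]
  note D' = insert_column_cells [of _ _ T r c, folded U]
  note P' = insert_column_points [of _ _ T r c, folded U]
  have PD: "(x, y) \<in> points T \<Longrightarrow> (x, y) \<in> cells T" for x y using tree_like_points [OF T] by blast
  obtain j where j: "(r, j) \<in> points T" using tree_like_row [OF T e(1)] by blast
  have "j \<le> c"
    using closed [OF PD [OF j], of r "Suc c"] e(2) by (cases "j \<le> c") auto
  with j have left: "\<exists>j<Suc c. (r, j) \<in> points U"
    by (intro exI [of _ j]) (simp add: P')
  have fin: "finite (cells U)"
  proof -
    have "new_cells (RightEdge (r, c)) = (\<lambda>i. (i, Suc c)) ` {..r}" by auto
    then have "finite (new_cells (RightEdge (r, c)))" by (metis finite_atMost finite_imageI)
    then show ?thesis using ferrers_finite [OF F] by (simp add: U insert_line_def)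
  qed
  have beyond: "x < r" if "(x, y) \<in> cells T" "c < y" for x y
    using closed [OF that(1), of r "Suc c"] e(2) that(2) by (cases "x < r") auto
  have "tree_like U"
  proof (rule tree_likeI)
    show "ferrers (cells U)"
    proof (rule ferrersI [OF fin])
      fix x y assume "(Suc x, y) \<in> cells U"
      then show "(x, y) \<in> cells U"
        using closed [of "Suc x" _ x] by (auto simp: D' split: if_splits)
    next
      fix x y assume "(x, Suc y) \<in> cells U"
      then show "(x, y) \<in> cells U"
        using closed [of x "Suc y" x y] closed [OF e(1), of x y] closed [of x y x "y - 1"] beyond [of x y]
        by (auto simp: D' not_le less_Suc_eq_le split: if_splits)
    qed
    show "points U \<subseteq> cells U"
      using PD by (auto simp: D' P' split: if_splits)
    show "(0, 0) \<in> points U" using tree_like_root [OF T] by (simp add: P')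
  next
    fix x y assume xy: "(x, y) \<in> points U" "(x, y) \<noteq> (0, 0)"
    consider "y \<le> c" | "y = Suc c" | y' where "y = Suc y'" "c < y'"
      by (metis Suc_lessE Suc_lessI not_less)
    then show "(\<exists>i'<x. (i', y) \<in> points U) \<noteq> (\<exists>j'<y. (x, j') \<in> points U)"
    proof cases
      case 1
      then have "(\<exists>i'<x. (i', y) \<in> points U) \<longleftrightarrow> (\<exists>i'<x. (i', y) \<in> points T)"
        "(\<exists>j'<y. (x, j') \<in> points U) \<longleftrightarrow> (\<exists>j'<y. (x, j') \<in> points T)"
        by (auto simp: P')
      then show ?thesis using tree_like_above_left [OF T, of x y] xy 1 by (simp add: P')
    next
      case 2
      then show ?thesis using xy left by (auto simp: P')
    next
      case 3
      then have xT: "(x, y') \<in> points T" "(x, y') \<noteq> (0, 0)" using xy by (auto simp: P')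
      then have "x < r" using beyond PD 3 by blast
      have "(\<exists>i'<x. (i', y) \<in> points U) \<longleftrightarrow> (\<exists>i'<x. (i', y') \<in> points T)"
        using 3 by (auto simp: P')
      \<comment> \<open>The only point in column \<open>Suc c\<close> is in row \<open>r\<close>,
        while \<open>x < r\<close>; so the row gains no point.\<close>
      moreover have "(\<exists>j'<y. (x, j') \<in> points U) \<longleftrightarrow> (\<exists>j'<y'. (x, j') \<in> points T)"
      proof
        assume "\<exists>j'<y. (x, j') \<in> points U"
        then obtain j' where "j' < y" "(x, j') \<in> points U" by blast
        then show "\<exists>j'<y'. (x, j') \<in> points T"
          using 3 \<open>x < r\<close>
          by (intro exI [of _ "if j' \<le> c then j' else j' - 1"]) (auto simp: P' split: if_splits)
      next
        assume "\<exists>j'<y'. (x, j') \<in> points T"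
        then obtain j' where "j' < y'" "(x, j') \<in> points T" by blast
        then show "\<exists>j'<y. (x, j') \<in> points U"
          using 3 by (intro exI [of _ "if j' \<le> c then j' else Suc j'"]) (auto simp: P')
      qed
      ultimately show ?thesis using tree_like_above_left [OF T xT] by simp
    qed
  next
    fix x y assume xy: "(x, y) \<in> cells U"
    have "\<exists>y'. (x, y') \<in> cells T"
      using xy closed [OF e(1), of x c] by (auto simp: D' split: if_splits)
    then obtain j' where "(x, j') \<in> points T" using tree_like_row [OF T] by blast
    then show "\<exists>j'. (x, j') \<in> points U"
      by (intro exI [of _ "if j' \<le> c then j' else Suc j'"]) (auto simp: P')
    show "\<exists>i'. (i', y) \<in> points U"
    proof (cases "y = Suc c")
      case True
      then show ?thesis by (simp add: P')
    next
      case False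
      then show ?thesis
        using xy tree_like_column [OF T, of x y] tree_like_column [OF T, of x "y - 1"]
        by (auto simp: D' P' split: if_splits)
    qed
  qed
  moreover have "corner U (r, Suc c)"
    using e by (auto simp: corner_def right_of_def below_def D' P')
  ultimately show ?thesis using left by blast
qed

section \<open>Deletion of a line as a preimage under the shift\<close>

definition delete_line :: "tableau \<Rightarrow> edge \<Rightarrow> tableau" where
  "delete_line T e = Tableau (shift_cell e -` cells T) (shift_cell e -` points T)"

lemma delete_line_cells [simp]: "p \<in> cells (delete_line T e) \<longleftrightarrow> shift_cell e p \<in> cells T"
  and delete_line_points [simp]: "p \<in> points (delete_line T e) \<longleftrightarrow> shift_cell e p \<in> points T"
  by (simp_all add: delete_line_def)

lemma inj_shift_cell: "inj (shift_cell e)"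
  by (cases e) (auto intro!: injI split: if_splits)

lemma shift_cell_not_new: "shift_cell e p \<notin> new_cells e"
  by (cases e; cases p) (auto split: if_splits)

lemma new_point_new: "new_point e \<in> new_cells e"
  by (cases e) auto

lemma delete_insert_line: "delete_line (insert_line T e) e = T"
proof -
  have "shift_cell e -` new_cells e = {}"
    using shift_cell_not_new by blast
  moreover have "shift_cell e -` {new_point e} = {}"
    using shift_cell_not_new new_point_new by (metis empty_iff insert_iff equals0I vimageE)
  ultimately show ?thesis
    using inj_shift_cell [of e] vimage_insert [of "shift_cell e" "new_point e" "shift_cell e ` points T"]
    by (simp add: insert_line_def delete_line_def vimage_Un inj_vimage_image_eq)
qed

lemma card_points_insert_line:
  assumes "tree_like T"
  shows "card (points (insert_line T e)) = Suc (card (points T))"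
proof -
  have "finite (points T)"
    using ferrers_finite tree_like_ferrers tree_like_points assms finite_subset by metis
  moreover have "new_point e \<notin> shift_cell e ` points T"
    using shift_cell_not_new new_point_new by (metis imageE)
  ultimately show ?thesis
    using inj_on_subset [OF inj_shift_cell subset_UNIV] by (simp add: insert_line_def card_image)
qed

text \<open>A point to the left excludes one above, and nothing lies below a corner, so the deleted
  column contains a single point. Its row keeps the left point, and the other rows lose
  none.\<close>

lemma delete_column:
  assumes U: "tree_like U" and p: "corner U (r, Suc c)" and left: "\<exists>j<Suc c. (r, j) \<in> points U"
    and T: "T = delete_line U (RightEdge (r, c))"
  shows "tree_like T \<and> (r, c) \<in> cells T \<and> (r, Suc c) \<notin> cells T \<and>
    insert_line T (RightEdge (r, c)) = U"
proof -
  note F = tree_like_ferrers [OF U]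
  note closed = ferrersD [OF F]
  have PD: "(x, y) \<in> points U \<Longrightarrow> (x, y) \<in> cells U" for x y using tree_like_points [OF U] by blast
  have p': "(r, Suc c) \<in> points U" "(r, Suc c) \<in> cells U" "(Suc r, Suc c) \<notin> cells U"
    "(r, Suc (Suc c)) \<notin> cells U"
    using p PD by (auto simp: corner_def right_of_def below_def)
  \<comment> \<open>\<open>h\<close> renumbers the columns of \<open>T\<close> as columns of
    \<open>U\<close>, skipping \<open>Suc c\<close>.\<close>
  define h where "h y = (if c < y then Suc y else y)" for y
  have h: "h y \<noteq> Suc c" "h 0 = 0" "(h y < h y') \<longleftrightarrow> y < y'" for y y' by (auto simp: h_def)
  have h_ex: "\<exists>y'. y = h y'" if "y \<noteq> Suc c" for y
    using that unfolding h_def by (intro exI [of _ "if y \<le> c then y else y - 1"]) auto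
  have D: "(x, y) \<in> cells T \<longleftrightarrow> (x, h y) \<in> cells U" for x y by (simp add: T h_def)
  have P: "(x, y) \<in> points T \<longleftrightarrow> (x, h y) \<in> points U" for x y by (simp add: T h_def)
  have no_above: "x = r" if "(x, Suc c) \<in> points U" for x
  proof -
    have "\<not> (\<exists>i'<r. (i', Suc c) \<in> points U)"
      using tree_like_above_left [OF U p'(1)] left by auto
    then have "r \<le> x" using that by (meson not_le)
    then show ?thesis using closed [OF PD [OF that], of "Suc r" "Suc c"] p'(3) by (cases "x = r") auto
  qed
  have "tree_like T"
  proof (rule tree_likeI)
    show "ferrers (cells T)"
    proof (rule ferrersI)
      show "finite (cells T)"
        using finite_vimageI [OF ferrers_finite [OF F] inj_shift_cell] by (simp add: T delete_line_def)
    qed (auto simp: D h_def split: if_splits elim: closed)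
    show "points T \<subseteq> cells T" using PD by (auto simp: D P)
    show "(0, 0) \<in> points T" using tree_like_root [OF U] by (simp add: P h)
  next
    fix x y assume xy: "(x, y) \<in> points T" "(x, y) \<noteq> (0, 0)"
    have xU: "(x, h y) \<in> points U" "(x, h y) \<noteq> (0, 0)"
      using xy by (auto simp: P h_def split: if_splits)
    have "(\<exists>j'<y. (x, j') \<in> points T) \<longleftrightarrow> (\<exists>j'<h y. (x, j') \<in> points U)"
    proof
      assume "\<exists>j'<y. (x, j') \<in> points T"
      then obtain j' where "j' < y" "(x, h j') \<in> points U" by (auto simp: P)
      then show "\<exists>j'<h y. (x, j') \<in> points U" using h(3) by blast
    next
      assume "\<exists>j'<h y. (x, j') \<in> points U"
      then obtain j' where j': "j' < h y" "(x, j') \<in> points U" by blast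
      \<comment> \<open>Otherwise \<open>j'\<close> belongs to the deleted point, but row
        \<open>r\<close> ends there and cannot contain a further point.\<close>
      have "j' \<noteq> Suc c"
      proof
        assume "j' = Suc c"
        then have "x = r" "Suc (Suc c) \<le> h y" using no_above j' by auto
        then show False using closed [OF PD [OF xU(1)], of r "Suc (Suc c)"] p'(4) by simp
      qed
      then obtain j where "j' = h j" using h_ex by blast
      then show "\<exists>j'<y. (x, j') \<in> points T" using j' h(3) by (auto simp: P)
    qed
    moreover have "(\<exists>i'<x. (i', y) \<in> points T) \<longleftrightarrow> (\<exists>i'<x. (i', h y) \<in> points U)"
      by (simp add: P)
    ultimately show "(\<exists>i'<x. (i', y) \<in> points T) \<noteq> (\<exists>j'<y. (x, j') \<in> points T)"
      using tree_like_above_left [OF U xU] by simp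
  next
    fix x y assume xy: "(x, y) \<in> cells T"
    then obtain j where j: "(x, j) \<in> points U" using tree_like_row [OF U] D by blast
    obtain j' where "(x, j') \<in> points U" "j' \<noteq> Suc c"
    proof (cases "j = Suc c")
      case True
      then show ?thesis using left no_above j that by blast
    qed (use j that in blast)
    then show "\<exists>j'. (x, j') \<in> points T" using h_ex P by metis
    show "\<exists>i'. (i', y) \<in> points T" using xy tree_like_column [OF U] D P by blast
  qed
  moreover have "(r, c) \<in> cells T" "(r, Suc c) \<notin> cells T"
    using p' closed [OF p'(2), of r c] by (auto simp: D h_def)
  moreover have "insert_line T (RightEdge (r, c)) = U"
  proof (rule tableau.expand, intro conjI)
    have col: "(x, Suc c) \<in> cells U \<longleftrightarrow> x \<le> r" for x
      using closed [OF p'(2), of x "Suc c"] closed [of x "Suc c" "Suc r" "Suc c"] p'(3)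
      by (cases "x \<le> r") auto
    have colp: "(x, Suc c) \<in> points U \<longleftrightarrow> x = r" for x
      using no_above p'(1) by blast
    have h1: "y \<noteq> Suc c \<Longrightarrow> \<not> y \<le> c \<Longrightarrow> h (y - Suc 0) = y" "y \<le> c \<Longrightarrow> h y = y" for y
      by (auto simp: h_def)
    show "cells (insert_line T (RightEdge (r, c))) = cells U"
      by (intro set_eqI, unfold split_paired_all insert_column_cells) (simp add: col D h1)
    show "points (insert_line T (RightEdge (r, c))) = points U"
      by (intro set_eqI, unfold split_paired_all insert_column_points) (simp add: colp P h1)
  qed
  ultimately show ?thesis by blast
qed

section \<open>Rows by transposition, and the bijection for line insertion\<close>

lemma insert_row:
  assumes "tree_like T" "(r, c) \<in> cells T" "(Suc r, c) \<notin> cells T"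
    and U: "U = insert_line T (BottomEdge (r, c))"
  shows "tree_like U \<and> corner U (Suc r, c) \<and> (\<exists>i<Suc r. (i, c) \<in> points U)"
proof -
  have "flip U = insert_line (flip T) (RightEdge (c, r))"
    using insert_line_flip [of T "BottomEdge (r, c)"] U by simp
  from insert_column [OF _ _ _ this] assms(1-3) show ?thesis by simp
qed

lemma delete_row:
  assumes "tree_like U" "corner U (Suc r, c)" "\<exists>i<Suc r. (i, c) \<in> points U"
  obtains T where "tree_like T" "(r, c) \<in> cells T" "(Suc r, c) \<notin> cells T"
    "insert_line T (BottomEdge (r, c)) = U"
proof -
  define T where "T = delete_line (flip U) (RightEdge (c, r))"
  have *: "tree_like T" "(c, r) \<in> cells T" "(c, Suc r) \<notin> cells T"
    "insert_line T (RightEdge (c, r)) = flip U"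
    using delete_column [of "flip U" c r T] assms T_def by auto
  then have "insert_line (flip T) (BottomEdge (r, c)) = U"
    using insert_line_flip [of T "RightEdge (c, r)"] by simp
  then show ?thesis using that [of "flip T"] * by simp
qed

lemma right_edge_boundary [simp]:
  "RightEdge (i, j) \<in> boundary_edges T \<longleftrightarrow> (i, j) \<in> cells T \<and> (i, Suc j) \<notin> cells T"
  and bottom_edge_boundary [simp]:
  "BottomEdge (i, j) \<in> boundary_edges T \<longleftrightarrow> (i, j) \<in> cells T \<and> (Suc i, j) \<notin> cells T"
  by (auto simp: boundary_edges_def)

lemma insert_line_corner:
  assumes "tree_like T" "e \<in> boundary_edges T"
  shows "tree_like (insert_line T e) \<and> corner (insert_line T e) (new_point e)"
proof (cases e)
  case (RightEdge q)
  then show ?thesis using insert_column [OF assms(1)] assms(2) by (cases q) simp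
next
  case (BottomEdge q)
  then show ?thesis using insert_row [OF assms(1)] assms(2) by (cases q) simp
qed

text \<open>Whether the marked point has a point to its left or above it determines the kind of
  edge, its position determines the cell of the edge, and deleting the line recovers
  \<open>T\<close>.\<close>

lemma bij_betw_insert_line:
  assumes "n \<ge> 1"
  shows "bij_betw (\<lambda>(T, e). (insert_line T e, new_point e))
    (SIGMA T:TLT n. boundary_edges T) (corner_tableaux (n + 1))"
proof (rule bij_betw_imageI)
  \<comment> \<open>The common new point would have a point both to its left and above it.\<close>
  have clash: False
    if "tree_like T" "RightEdge (r, c) \<in> boundary_edges T"
      "tree_like T'" "BottomEdge (r', c') \<in> boundary_edges T'"
      "insert_line T (RightEdge (r, c)) = insert_line T' (BottomEdge (r', c'))"
      "new_point (RightEdge (r, c)) = new_point (BottomEdge (r', c'))" for T T' r c r' c'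
  proof -
    define U where "U = insert_line T (RightEdge (r, c))"
    have "tree_like U" "corner U (r, Suc c)" "\<exists>j<Suc c. (r, j) \<in> points U"
      using insert_column [OF that(1) _ _ U_def] that(2) by auto
    moreover have "\<exists>i<r. (i, Suc c) \<in> points U"
      using insert_row [OF that(3), of r' c' U] that(4-6) by (auto simp: U_def)
    ultimately show False
      using tree_like_above_left [of U r "Suc c"] by (auto simp: corner_def)
  qed
  show "inj_on (\<lambda>(T, e). (insert_line T e, new_point e)) (SIGMA T:TLT n. boundary_edges T)"
  proof (rule inj_onI)
    fix x y assume A: "x \<in> (SIGMA T:TLT n. boundary_edges T)" "y \<in> (SIGMA T:TLT n. boundary_edges T)"
      "(\<lambda>(T, e). (insert_line T e, new_point e)) x = (\<lambda>(T, e). (insert_line T e, new_point e)) y"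
    obtain T e T' e' where xy: "x = (T, e)" "y = (T', e')" by (cases x; cases y) auto
    have eq: "insert_line T e = insert_line T' e'" "new_point e = new_point e'"
      using A(3) xy by auto
    have B: "tree_like T" "e \<in> boundary_edges T" "tree_like T'" "e' \<in> boundary_edges T'"
      using A(1,2) xy by (auto simp: TLT_def)
    have "e = e'"
    proof (cases e; cases e')
      fix q q' assume "e = RightEdge q" "e' = BottomEdge q'"
      then show ?thesis
        using clash [OF B(1) _ B(3), of "fst q" "snd q" "fst q'" "snd q'"] B(2,4) eq by simp
    next
      fix q q' assume "e = BottomEdge q" "e' = RightEdge q'"
      then show ?thesis
        using clash [OF B(3) _ B(1), of "fst q'" "snd q'" "fst q" "snd q"] B(2,4) eq by simp
    next
      fix q q' assume "e = RightEdge q" "e' = RightEdge q'"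
      then show ?thesis using eq(2) by (cases q; cases q') simp
    next
      fix q q' assume "e = BottomEdge q" "e' = BottomEdge q'"
      then show ?thesis using eq(2) by (cases q; cases q') simp
    qed
    moreover have "T = T'" using delete_insert_line eq(1) \<open>e = e'\<close> by metis
    ultimately show "x = y" using xy by simp
  qed
  show "(\<lambda>(T, e). (insert_line T e, new_point e)) ` (SIGMA T:TLT n. boundary_edges T)
    = corner_tableaux (n + 1)"
  proof (intro equalityI subsetI)
    fix x assume "x \<in> (\<lambda>(T, e). (insert_line T e, new_point e)) ` (SIGMA T:TLT n. boundary_edges T)"
    then show "x \<in> corner_tableaux (n + 1)"
      using insert_line_corner card_points_insert_line
      by (auto simp: corner_tableaux_def TLT_def)
  next
    fix x assume "x \<in> corner_tableaux (n + 1)"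
    then obtain U r c where x: "x = (U, (r, c))" and U: "tree_like U" "card (points U) = n + 1"
      and p: "corner U (r, c)"
      by (cases x) (auto simp: corner_tableaux_def TLT_def)
    \<comment> \<open>A root that is a corner is the only cell, but \<open>n \<ge> 1\<close> gives
      at least two points.\<close>
    have "(r, c) \<noteq> (0, 0)"
    proof
      assume "(r, c) = (0, 0)"
      then have "(0, Suc 0) \<notin> cells U" "(Suc 0, 0) \<notin> cells U"
        using p by (auto simp: corner_def right_of_def below_def)
      then have "(i, j) = (0, 0)" if "(i, j) \<in> cells U" for i j
        using ferrersD [OF tree_like_ferrers [OF U(1)] that, of 0 "Suc 0"]
          ferrersD [OF tree_like_ferrers [OF U(1)] that, of "Suc 0" 0] by (cases i; cases j) auto
      then have "points U \<subseteq> {(0, 0)}" using tree_like_points [OF U(1)] by auto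
      then have "card (points U) \<le> 1" using card_mono [of "{(0, 0)}" "points U"] by simp
      then show False using U(2) assms by simp
    qed
    then have above_left: "(\<exists>i'<r. (i', c) \<in> points U) \<noteq> (\<exists>j'<c. (r, j') \<in> points U)"
      using tree_like_above_left [OF U(1)] p by (simp add: corner_def)
    obtain T e where T: "tree_like T" "e \<in> boundary_edges T" "insert_line T e = U"
      "new_point e = (r, c)"
    proof (cases "\<exists>j'<c. (r, j') \<in> points U")
      case True
      then obtain c' where c: "c = Suc c'" by (cases c) auto
      then show ?thesis
        using delete_column [OF U(1), of r c' "delete_line U (RightEdge (r, c'))"] p True
          that [of "delete_line U (RightEdge (r, c'))" "RightEdge (r, c')"] by simp
    next
      case False
      then have *: "\<exists>i'<r. (i', c) \<in> points U" using above_left by simp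
      then obtain r' where r: "r = Suc r'" by (cases r) auto
      show ?thesis
        using delete_row [OF U(1), of r' c] p * r that [of _ "BottomEdge (r', c)"] by auto
    qed
    then have "card (points T) = n" using card_points_insert_line [OF T(1), of e] U(2) by simp
    then have "(T, e) \<in> (SIGMA T:TLT n. boundary_edges T)" using T by (simp add: TLT_def)
    then show "x \<in> (\<lambda>(T, e). (insert_line T e, new_point e)) ` (SIGMA T:TLT n. boundary_edges T)"
      using T x by force
  qed
qed

section \<open>The special point after a line insertion\<close>

lemma insert_row_cells:
  "(x, y) \<in> cells (insert_line T (BottomEdge (r, c))) \<longleftrightarrow>
    (if x \<le> r then (x, y) \<in> cells T else if x = Suc r then y \<le> c else (x - 1, y) \<in> cells T)"
  using insert_column_cells [of y x "flip T" c r] insert_line_flip [of T "BottomEdge (r, c)"] by simp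

lemma insert_row_points:
  "(x, y) \<in> points (insert_line T (BottomEdge (r, c))) \<longleftrightarrow>
    (if x \<le> r then (x, y) \<in> points T else if x = Suc r then y = c else (x - 1, y) \<in> points T)"
  using insert_column_points [of y x "flip T" c r] insert_line_flip [of T "BottomEdge (r, c)"] by simp

lemma is_special_pair:
  "is_special T (i, j) \<longleftrightarrow> (i, j) \<in> points T \<and> (Suc i, j) \<notin> cells T \<and>
    (\<forall>x y. (x, y) \<in> points T \<longrightarrow> (Suc x, y) \<notin> cells T \<longrightarrow> y \<le> j)"
  by (auto simp: is_special_def column_bottom_points_def)

text \<open>Closure turns the comparison of the columns \<open>j\<close> and \<open>c\<close> into
  one of edge positions. The pointed bottom of the new column is rightmost if
  \<open>j \<le> c\<close>; otherwise the old special point moves along and stays rightmost.\<close>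

lemma special_point_insert_column:
  assumes T: "tree_like T" and e: "e = RightEdge (r, c)" "e \<in> boundary_edges T"
    and s: "special_point T = (i, j)"
  shows "if j \<le> c then edge_pos (BottomEdge (i, j)) < edge_pos e \<and>
      is_special (insert_line T e) (new_point e)
    else edge_pos e \<le> edge_pos (BottomEdge (i, j)) \<and> is_special (insert_line T e) (shift_cell e (i, j))"
proof -
  note closed = ferrersD [OF tree_like_ferrers [OF T]]
  have rc: "(r, c) \<in> cells T" "(r, Suc c) \<notin> cells T" using e by auto
  have sp: "(i, j) \<in> points T" "(Suc i, j) \<notin> cells T"
    and max: "\<And>x y. (x, y) \<in> points T \<Longrightarrow> (Suc x, y) \<notin> cells T \<Longrightarrow> y \<le> j"
    using special_point [OF T] s by (auto simp: is_special_pair)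
  have ij: "(i, j) \<in> cells T" using sp tree_like_points [OF T] by blast
  show ?thesis
  proof (cases "j \<le> c")
    case True
    have "r \<le> i" using closed [OF rc(1), of "Suc i" j] sp(2) True by (cases "r \<le> i") auto
    moreover have "is_special (insert_line T e) (r, Suc c)"
      unfolding is_special_pair
    proof (intro conjI allI impI)
      fix x y
      assume xy: "(x, y) \<in> points (insert_line T e)" "(Suc x, y) \<notin> cells (insert_line T e)"
      then show "y \<le> Suc c"
        using max [of x "y - 1"] True
        by (auto simp: e insert_column_cells insert_column_points split: if_splits)
    qed (simp_all add: e insert_column_cells insert_column_points)
    ultimately show ?thesis using True e by simp
  next
    case False
    have "i < r" using closed [OF ij, of r "Suc c"] rc(2) False by (cases "i < r") auto
    moreover have "is_special (insert_line T e) (i, Suc j)"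
      unfolding is_special_pair
    proof (intro conjI allI impI)
      fix x y
      assume xy: "(x, y) \<in> points (insert_line T e)" "(Suc x, y) \<notin> cells (insert_line T e)"
      then show "y \<le> Suc j"
        using max [of x "y - 1"] False
        by (auto simp: e insert_column_cells insert_column_points split: if_splits)
    qed (use False sp in \<open>simp_all add: e insert_column_cells insert_column_points\<close>)
    ultimately show ?thesis using False e by simp
  qed
qed

lemma special_point_insert_row:
  assumes T: "tree_like T" and e: "e = BottomEdge (r, c)" "e \<in> boundary_edges T"
    and s: "special_point T = (i, j)"
  shows "if j \<le> c then
      (edge_pos (BottomEdge (i, j)) < edge_pos e \<or> e = BottomEdge (i, j)) \<and>
      is_special (insert_line T e) (new_point e)
    else edge_pos e \<le> edge_pos (BottomEdge (i, j)) \<and> is_special (insert_line T e) (shift_cell e (i, j))"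
proof -
  note closed = ferrersD [OF tree_like_ferrers [OF T]]
  have rc: "(r, c) \<in> cells T" "(Suc r, c) \<notin> cells T" using e by auto
  have sp: "(i, j) \<in> points T" "(Suc i, j) \<notin> cells T"
    and max: "\<And>x y. (x, y) \<in> points T \<Longrightarrow> (Suc x, y) \<notin> cells T \<Longrightarrow> y \<le> j"
    using special_point [OF T] s by (auto simp: is_special_pair)
  have PD: "(x, y) \<in> points T \<Longrightarrow> (x, y) \<in> cells T" for x y using tree_like_points [OF T] by blast
  have beyond: "x \<le> r" if "(x, y) \<in> cells T" "c \<le> y" for x y
    using closed [OF that(1), of "Suc r" c] rc(2) that(2) by (cases "x \<le> r") auto
  \<comment> \<open>A pointed bottom beyond column \<open>c\<close> lies in row \<open>r\<close> or
    above, where the inserted row changes nothing.\<close>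
  have max': "y \<le> max c j"
    if "(x, y) \<in> points (insert_line T e)" "(Suc x, y) \<notin> cells (insert_line T e)" for x y
  proof (rule ccontr)
    assume "\<not> y \<le> max c j"
    then have y: "c < y" "j < y" by auto
    then have "x \<le> r"
      using that(1) beyond [OF PD, of "x - 1" y]
      by (auto simp: e insert_row_points split: if_splits)
    then have "(x, y) \<in> points T" "(Suc x, y) \<notin> cells T"
      using that beyond [of "Suc x" y] y by (auto simp: e insert_row_points insert_row_cells split: if_splits)
    then show False using max [of x y] y by simp
  qed
  show ?thesis
  proof (cases "j \<le> c")
    case True
    have "r \<le> i" using closed [OF rc(1), of "Suc i" j] sp(2) True by (cases "r \<le> i") auto
    \<comment> \<open>Equal columns mean that \<open>e\<close> is the bottom edge of the special
      cell, which has no strictly larger position.\<close>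
    moreover have "i = r" if "j = c" using beyond [OF PD [OF sp(1)]] that \<open>r \<le> i\<close> by simp
    moreover have "is_special (insert_line T e) (Suc r, c)"
      unfolding is_special_pair
    proof (intro conjI allI impI)
      fix x y
      assume "(x, y) \<in> points (insert_line T e)" "(Suc x, y) \<notin> cells (insert_line T e)"
      then show "y \<le> c" using max' [of x y] True by simp
    qed (use rc in \<open>simp_all add: e insert_row_cells insert_row_points\<close>)
    ultimately show ?thesis using True e by auto
  next
    case False
    have "i \<le> r" using beyond [OF PD [OF sp(1)]] False by simp
    moreover have "is_special (insert_line T e) (i, j)"
      unfolding is_special_pair
    proof (intro conjI allI impI)
      fix x y
      assume "(x, y) \<in> points (insert_line T e)" "(Suc x, y) \<notin> cells (insert_line T e)"
      then show "y \<le> j" using max' [of x y] False by simp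
    qed (use False sp \<open>i \<le> r\<close> in \<open>simp_all add: e insert_row_cells insert_row_points\<close>)
    ultimately show ?thesis using False e by simp
  qed
qed

text \<open>The test on edge positions holds exactly if the new point is already special in the
  intermediate tableau. Otherwise \<open>ribbon_eq\<close> identifies the ribbon with a
  strip.\<close>

lemma Insertpoint_eq_add_ribbon:
  assumes T: "tree_like T" and e: "e \<in> boundary_edges T"
  shows "Insertpoint T e = add_ribbon (insert_line T e, new_point e)"
proof -
  let ?U = "insert_line T e" and ?s = "special_point T"
  let ?c = "edge_pos (BottomEdge ?s) < edge_pos e \<or> e = BottomEdge ?s"
  have U: "tree_like ?U" "corner ?U (new_point e)" using insert_line_corner [OF assms] by auto
  obtain i j where s: "?s = (i, j)" by fastforce
  have *: "if ?c then special_point ?U = new_point e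
    else special_point ?U = shift_cell e ?s \<and> shift_cell e ?s \<noteq> new_point e"
  proof (cases e)
    case (RightEdge q)
    obtain r c where "q = (r, c)" by fastforce
    with RightEdge show ?thesis
      using special_point_insert_column [OF T _ e s] special_point_eqI [OF U(1)] s
      by (cases "j \<le> c") auto
  next
    case (BottomEdge q)
    obtain r c where "q = (r, c)" by fastforce
    with BottomEdge show ?thesis
      using special_point_insert_row [OF T _ e s] special_point_eqI [OF U(1)] s
      by (cases "j \<le> c") auto
  qed
  show ?thesis
  proof (cases ?c)
    case True
    then show ?thesis using * by (auto simp: Insertpoint_def Let_def add_ribbon_special)
  next
    case False
    obtain r c i' j' where new: "new_point e = (r, c)" "shift_cell e ?s = (i', j')" by fastforce
    have sp: "special_point ?U = (i', j')" "(i', j') \<noteq> (r, c)" using * False new by auto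
    interpret strip "cells ?U" r c i' j'
      using strip_special [OF U(1) _ sp] U(2) new by simp
    have "Insertpoint T e = Tableau (cells ?U \<union> R) (points ?U)"
      using False ribbon_eq
      by (auto simp: Insertpoint_def Let_def right_of_def below_def new)
    then show ?thesis using sp new by (auto simp: add_ribbon_def)
  qed
qed

section \<open>Boundary edges\<close>

text \<open>Both sets project bijectively to the row indices: a row has one leftmost point and one
  right end.\<close>

lemma card_rows:
  assumes "tree_like T"
  shows "card {(i, j) \<in> points T. \<not> (\<exists>j'<j. (i, j') \<in> points T)} =
    card {(i, j) \<in> cells T. (i, Suc j) \<notin> cells T}" (is "card ?L = card ?E")
proof -
  note F = tree_like_ferrers [OF assms]
  note closed = ferrersD [OF F]
  let ?I = "fst ` cells T"
  have PD: "(x, y) \<in> points T \<Longrightarrow> (x, y) \<in> cells T" for x y using tree_like_points [OF assms] by blast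
  have "bij_betw fst ?L ?I"
  proof (rule bij_betw_imageI)
    have "j = j'" if "(i, j) \<in> ?L" "(i, j') \<in> ?L" for i j j'
      using that by (cases j j' rule: linorder_cases) auto
    then show "inj_on fst ?L" by (intro inj_onI) (auto simp: prod_eq_iff)
    have "i \<in> fst ` ?L" if ij: "(i, j) \<in> cells T" for i j
    proof -
      obtain j where "(i, j) \<in> points T" "\<forall>j'<j. (i, j') \<notin> points T"
        using tree_like_row [OF assms ij] exists_least_iff [of "\<lambda>j. (i, j) \<in> points T"] by blast
      then show ?thesis by (intro image_eqI [of _ _ "(i, j)"]) auto
    qed
    then show "fst ` ?L = ?I" using PD by force
  qed
  moreover have "bij_betw fst ?E ?I"
  proof (rule bij_betw_imageI)
    have "j = j'" if "(i, j) \<in> ?E" "(i, j') \<in> ?E" for i j j'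
      using that closed [of i j i "Suc j'"] closed [of i j' i "Suc j"]
      by (cases j j' rule: linorder_cases) auto
    then show "inj_on fst ?E" by (intro inj_onI) (auto simp: prod_eq_iff)
    have "i \<in> fst ` ?E" if "(i, j) \<in> cells T" for i j
    proof -
      have fin: "finite {j. (i, j) \<in> cells T}"
        using finite_vimageI [OF ferrers_finite [OF F], of "Pair i"] by (simp add: vimage_def inj_def)
      define m where "m = Max {j. (i, j) \<in> cells T}"
      have "(i, m) \<in> cells T" using Max_in [OF fin] that unfolding m_def by blast
      moreover have "(i, Suc m) \<notin> cells T" using Max_ge [OF fin, of "Suc m"] unfolding m_def by auto
      ultimately show ?thesis by (intro image_eqI [of _ _ "(i, m)"]) auto
    qed
    then show "fst ` ?E = ?I" by force
  qed
  ultimately show ?thesis by (simp add: bij_betw_same_card)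
qed

lemma card_columns:
  assumes "tree_like T"
  shows "card {(i, j) \<in> points T. \<not> (\<exists>i'<i. (i', j) \<in> points T)} =
    card {(i, j) \<in> cells T. (Suc i, j) \<notin> cells T}"
proof -
  have eq: "prod.swap ` {(i, j) \<in> points T. \<not> (\<exists>i'<i. (i', j) \<in> points T)} =
      {(i, j) \<in> points (flip T). \<not> (\<exists>j'<j. (i, j') \<in> points (flip T))}"
    "prod.swap ` {(i, j) \<in> cells T. (Suc i, j) \<notin> cells T} =
      {(i, j) \<in> cells (flip T). (i, Suc j) \<notin> cells (flip T)}"
    by auto
  have card_swap: "card (prod.swap ` A) = card A" for A :: "cell set"
    by (simp add: card_image)
  show ?thesis
    using card_rows [OF tree_like_flipI [OF assms]] unfolding eq [symmetric] card_swap .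
qed

text \<open>Inclusion-exclusion for the leftmost points of rows and the topmost points of
  columns.\<close>

lemma card_boundary_edges:
  assumes "tree_like T"
  shows "card (boundary_edges T) = card (points T) + 1"
proof -
  let ?R = "{(i, j) \<in> cells T. (i, Suc j) \<notin> cells T}"
  let ?B = "{(i, j) \<in> cells T. (Suc i, j) \<notin> cells T}"
  let ?L = "{(i, j) \<in> points T. \<not> (\<exists>j'<j. (i, j') \<in> points T)}"
  let ?A = "{(i, j) \<in> points T. \<not> (\<exists>i'<i. (i', j) \<in> points T)}"
  have fin: "finite (cells T)" using ferrers_finite tree_like_ferrers assms by blast
  then have finp: "finite (points T)" using tree_like_points [OF assms] finite_subset by blast
  have "finite ?R" "finite ?B" "finite ?L" "finite ?A"
    by (rule finite_subset [OF _ fin], force)+ (rule finite_subset [OF _ finp], force)+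
  have "boundary_edges T = RightEdge ` ?R \<union> BottomEdge ` ?B"
    unfolding boundary_edges_def by auto
  moreover have "card (RightEdge ` ?R \<union> BottomEdge ` ?B) = card ?R + card ?B"
    using \<open>finite ?R\<close> \<open>finite ?B\<close> by (subst card_Un_disjoint) (auto simp: card_image inj_on_def)
  moreover have "card ?L = card ?R" "card ?A = card ?B"
    using card_rows [OF assms] card_columns [OF assms] by auto
  moreover have "?L \<union> ?A = points T"
  proof -
    \<comment> \<open>A non-root point does not have points both above and to its left.\<close>
    have "(i, j) \<in> ?L \<union> ?A" if "(i, j) \<in> points T" for i j
      using tree_like_above_left [OF assms that] that by (cases "(i, j) = (0, 0)") auto
    then show ?thesis by auto
  qed
  moreover have "?L \<inter> ?A = {(0, 0)}"
  proof -
    \<comment> \<open>A non-root point has at least one of the two.\<close>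
    have "(i, j) = (0, 0)" if "(i, j) \<in> ?L \<inter> ?A" for i j
      using tree_like_above_left [OF assms, of i j] that by (cases "(i, j) = (0, 0)") auto
    then have "?L \<inter> ?A \<subseteq> {(0, 0)}" 
      by (intro subsetI, unfold split_paired_all) (simp only: singleton_iff)
    moreover have "(0, 0) \<in> ?L \<inter> ?A" using tree_like_root [OF assms] by simp
    ultimately show ?thesis by blast
  qed
  ultimately show ?thesis
    using card_Un_Int [OF \<open>finite ?L\<close> \<open>finite ?A\<close>] by simp
qed

theorem theorem2p3:
  fixes n :: nat
  assumes "n \<ge> 1"
  shows "(\<forall>T\<in>TLT n. card (boundary_edges T) = n + 1) \<and>
    bij_betw (\<lambda>(T, e). Insertpoint T e) (SIGMA T:TLT n. boundary_edges T) (TLT (n + 1))"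
proof
  show "\<forall>T\<in>TLT n. card (boundary_edges T) = n + 1"
    using card_boundary_edges by (simp add: TLT_def)
  have "bij_betw (add_ribbon \<circ> (\<lambda>(T, e). (insert_line T e, new_point e)))
      (SIGMA T:TLT n. boundary_edges T) (TLT (n + 1))"
    using bij_betw_trans [OF bij_betw_insert_line [OF assms] bij_betw_add_ribbon] .
  then show "bij_betw (\<lambda>(T, e). Insertpoint T e) (SIGMA T:TLT n. boundary_edges T) (TLT (n + 1))"
    \<comment> \<open>The composite and \<open>Insertpoint\<close> are compared on the domain only,
      where \<open>e\<close> is a boundary edge of a tree-like \<open>T\<close>.\<close>
    by (rule bij_betw_cong [THEN iffD1, rotated])
      (auto simp: TLT_def Insertpoint_eq_add_ribbon)
qed

end
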